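(* Let $n,d\ge1$, let $\ell=\binom{n+d}{d}-1$, and let $\mathbb{P}^\ell$ be the projectivization of the space of homogeneous polynomials of degree $d$ in $n+1$ variables with coefficients in $\mathbb{Q}_p$. Let $\nu:\mathbb{P}^n\to\mathbb{P}^\ell$ be the Veronese map $$\nu:[x_0,\ldots,x_n]\mapsto\left[(x_0^{\alpha_0}\cdots x_n^{\alpha_n})_{|\alpha|=d}\right].$$ Then $\mathrm{vol}_n(\nu(\mathbb{P}^n))=\mathrm{vol}_n(\mathbb{P}^n)$.
   Context: Let $p$ be a prime, $|p|_p=p^{-1}$, $\|(a_0,\ldots,a_N)\|_p=\max_i|a_i|_p$. $\mathbb{P}^N$ denotes $\mathbb{P}^N(\mathbb{Q}_p)$ (coordinates on $\mathbb{P}^\ell$ are indexed by multi-indices $\alpha$ with $|\alpha|=d$); $S^N=\{a\in\mathbb{Q}_p^{N+1}:\|a\|_p=1\}$, $\varphi:S^N\to\mathbb{P}^N$ is the natural projection. Metric on $\mathbb{P}^N$: $d(x,y)=\|\hat x\wedge\hat y\|_p$ for any $\hat x\in\varphi^{-1}(x)$, $\hat y\in\varphi^{-1}(y)$ (maximal absolute value of $2\times2$ minors); $B(x,r)=\{y:d(x,y)\le r\}$. Measure on $\mathbb{P}^N$: $\mu(U)=\frac{1}{1-p^{-1}}\mu(\varphi^{-1}(U))$, where on $\mathbb{Q}_p^{N+1}$ $\mu$ is the Haar measure with $\mu(\mathbb{Z}_p^{N+1})=1$. For an algebraic set $Y\subseteq\mathbb{P}^N$ of dimension $k$, $\mathrm{vol}_k(Y)=\lim_{m\to\infty}p^{m(N-k)}\mu\big(\bigcup_{x\in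 Y}B(x,p^{-m})\big)$ (the limit exists and is finite). *)

theory Defs
  imports "HOL-Analysis.Analysis" "Berlekamp_Zassenhaus.Finite_Field"
begin

section \<open>The field of p-adic numbers\<close>

subsection \<open>The p-adic absolute value on the rationals\<close>

definition rat_padic_abs :: "nat \<Rightarrow> rat \<Rightarrow> real" where
  "rat_padic_abs p q =
     (if q = 0 then 0
      else case quotient_of q of (a, b) \<Rightarrow>
        real p powi (int (multiplicity (int p) b) - int (multiplicity (int p) a)))"

lemma rat_padic_abs_divide:
  assumes p: "prime p" and a: "a \<noteq> 0" and b: "b \<noteq> 0"
  shows "rat_padic_abs p (of_int a / of_int b) =
           real p powi (int (multiplicity (int p) b) - int (multiplicity (int p) a))"
proof -
  obtain a' b' where q: "quotient_of (of_int a / of_int b) = (a', b')"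
    by force
  have b': "b' > 0" using quotient_of_denom_pos[OF q] .
  have eq: "(of_int a / of_int b :: rat) = of_int a' / of_int b'"
    using quotient_of_div[OF q] .
  have a': "a' \<noteq> 0" using eq a b by auto
  have "(of_int (a * b') :: rat) = of_int (a' * b)"
    using eq b b' by (simp add: field_simps)
  then have ab: "a * b' = a' * b" by (simp only: of_int_eq_iff)
  have pe: "prime_elem (int p)" using p by simp
  have "multiplicity (int p) a + multiplicity (int p) b'
      = multiplicity (int p) a' + multiplicity (int p) b"
    using ab a b a' b' prime_elem_multiplicity_mult_distrib[OF pe] by (metis less_irrefl)
  then have "int (multiplicity (int p) b') - int (multiplicity (int p) a')
      = int (multiplicity (int p) b) - int (multiplicity (int p) a)" by linarith
  then show ?thesis using a b q by (simp add: rat_padic_abs_def)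
qed

lemma rat_padic_abs_0 [simp]: "rat_padic_abs p 0 = 0"
  by (simp add: rat_padic_abs_def)

lemma rat_padic_abs_nonneg [simp]: "rat_padic_abs p q \<ge> 0"
  by (auto simp: rat_padic_abs_def split: prod.splits)

lemma rat_cases_common_denom:
  fixes x y :: rat
  obtains a b c where "b \<noteq> 0" "x = of_int a / of_int b" "y = of_int c / of_int b"
proof -
  obtain a1 b1 where 1: "quotient_of x = (a1, b1)" by force
  obtain a2 b2 where 2: "quotient_of y = (a2, b2)" by force
  have b1: "b1 > 0" and b2: "b2 > 0"
    using quotient_of_denom_pos[OF 1] quotient_of_denom_pos[OF 2] .
  show thesis
    by (rule that[of "b1 * b2" "a1 * b2" "a2 * b1"])
       (use b1 b2 quotient_of_div[OF 1] quotient_of_div[OF 2] in auto)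
qed

context
  fixes p :: nat
  assumes p: "prime p"
begin

lemma rat_padic_abs_1 [simp]: "rat_padic_abs p 1 = 1"
  using rat_padic_abs_divide[OF p, of 1 1] by simp

lemma rat_padic_abs_eq_0_iff [simp]: "rat_padic_abs p q = 0 \<longleftrightarrow> q = 0"
  using p by (auto simp: rat_padic_abs_def split: prod.splits)

lemma rat_padic_abs_minus [simp]: "rat_padic_abs p (- q) = rat_padic_abs p q"
proof (cases "q = 0")
  case False
  obtain a b c where ab: "b \<noteq> 0" "q = of_int a / of_int b" "q = of_int c / of_int b"
    by (rule rat_cases_common_denom)
  with False have "a \<noteq> 0" by auto
  moreover have "- q = of_int (- a) / of_int b" using ab by simp
  ultimately show ?thesis
    using ab rat_padic_abs_divide[OF p, of a b] rat_padic_abs_divide[OF p, of "- a" b]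
      multiplicity_times_unit_right[of "- 1" "int p" a]
    by simp
qed auto

lemma rat_padic_abs_mult:
  "rat_padic_abs p (x * y) = rat_padic_abs p x * rat_padic_abs p y"
proof (cases "x = 0 \<or> y = 0")
  case False
  obtain a b c where ab: "b \<noteq> 0" "x = of_int a / of_int b" "y = of_int c / of_int b"
    by (rule rat_cases_common_denom)
  with False have nz: "a \<noteq> 0" "c \<noteq> 0" by auto
  have pe: "prime_elem (int p)" using p by simp
  have "x * y = of_int (a * c) / of_int (b * b)" using ab by simp
  then have "rat_padic_abs p (x * y) = real p powi
      (int (multiplicity (int p) (b * b)) - int (multiplicity (int p) (a * c)))"
    using rat_padic_abs_divide[OF p, of "a * c" "b * b"] nz ab by simp
  also have "\<dots> = real p powi
      ((int (multiplicity (int p) b) - int (multiplicity (int p) a))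
      + (int (multiplicity (int p) b) - int (multiplicity (int p) c)))"
    using prime_elem_multiplicity_mult_distrib[OF pe] nz ab
    by (simp add: algebra_simps)
  also have "\<dots> = rat_padic_abs p x * rat_padic_abs p y"
    using p nz ab rat_padic_abs_divide[OF p, of a b] rat_padic_abs_divide[OF p, of c b]
    by (subst power_int_add) auto
  finally show ?thesis .
qed auto

lemma rat_padic_abs_inverse:
  "rat_padic_abs p (inverse x) = inverse (rat_padic_abs p x)"
proof (cases "x = 0")
  case False
  then have "rat_padic_abs p x * rat_padic_abs p (inverse x) = 1"
    by (simp flip: rat_padic_abs_mult)
  then show ?thesis by (metis inverse_unique)
qed auto

lemma rat_padic_abs_ultrametric:
  "rat_padic_abs p (x + y) \<le> max (rat_padic_abs p x) (rat_padic_abs p y)"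
proof (cases "x = 0 \<or> y = 0 \<or> x + y = 0")
  case False
  obtain a b c where ab: "b \<noteq> 0" "x = of_int a / of_int b" "y = of_int c / of_int b"
    by (rule rat_cases_common_denom)
  have s: "x + y = of_int (a + c) / of_int b" using ab by (simp add: add_divide_distrib)
  with False ab have nz: "a \<noteq> 0" "c \<noteq> 0" "a + c \<noteq> 0" by auto
  let ?v = "multiplicity (int p)"
  have "int p ^ min (?v a) (?v c) dvd a + c"
    by (intro dvd_add multiplicity_dvd') auto
  then have "min (?v a) (?v c) \<le> ?v (a + c)"
    using p nz by (intro multiplicity_geI) auto
  then consider "?v a \<le> ?v (a + c)" | "?v c \<le> ?v (a + c)" by linarith
  then have "rat_padic_abs p (x + y) \<le> rat_padic_abs p x \<or>
      rat_padic_abs p (x + y) \<le> rat_padic_abs p y"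
  proof cases
    case 1
    then show ?thesis
      using nz ab s p prime_ge_1_nat[OF p] rat_padic_abs_divide[OF p, of "a + c" b] rat_padic_abs_divide[OF p, of a b]
      by (auto intro!: disjI1 power_int_increasing)
  next
    case 2
    then show ?thesis
      using nz ab s p prime_ge_1_nat[OF p] rat_padic_abs_divide[OF p, of "a + c" b] rat_padic_abs_divide[OF p, of c b]
      by (auto intro!: disjI2 power_int_increasing)
  qed
  then show ?thesis by linarith
qed (auto simp: max_def)

lemma rat_padic_abs_triangle:
  "rat_padic_abs p (x + y) \<le> rat_padic_abs p x + rat_padic_abs p y"
  using rat_padic_abs_ultrametric[of x y] rat_padic_abs_nonneg[of p x]
    rat_padic_abs_nonneg[of p y] by linarith

lemma rat_padic_abs_commute:
  "rat_padic_abs p (x - y) = rat_padic_abs p (y - x)"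
  using rat_padic_abs_minus[of "x - y"] by simp

lemma rat_padic_abs_triangle3:
  "\<bar>rat_padic_abs p x - rat_padic_abs p y\<bar> \<le> rat_padic_abs p (x - y)"
  using rat_padic_abs_triangle[of "x - y" y] rat_padic_abs_triangle[of "y - x" x]
    rat_padic_abs_commute[of x y] by auto

end

subsection \<open>Cauchy sequences and their quotient by the null sequences\<close>

definition padic_Cauchy :: "nat \<Rightarrow> (nat \<Rightarrow> rat) \<Rightarrow> bool" where
  "padic_Cauchy p X \<longleftrightarrow>
     (\<forall>e>0. \<exists>N. \<forall>m\<ge>N. \<forall>n\<ge>N. rat_padic_abs p (X m - X n) < e)"

definition padic_null :: "nat \<Rightarrow> (nat \<Rightarrow> rat) \<Rightarrow> bool" where
  "padic_null p X \<longleftrightarrow> (\<lambda>n. rat_padic_abs p (X n)) \<longlonglongrightarrow> 0"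

lemma padic_Cauchy_const: "padic_Cauchy p (\<lambda>_. c)"
  by (auto simp: padic_Cauchy_def)

lemma padic_null_0: "padic_null p (\<lambda>_. 0)"
  by (auto simp: padic_null_def)

context
  fixes p :: nat
  assumes p: "prime p"
begin

lemma padic_Cauchy_abs:
  assumes "padic_Cauchy p X"
  shows "convergent (\<lambda>n. rat_padic_abs p (X n))"
proof -
  have "Cauchy (\<lambda>n. rat_padic_abs p (X n))"
    unfolding Cauchy_def
  proof (intro allI impI)
    fix e :: real assume "e > 0"
    then obtain N where N: "\<And>m n. m \<ge> N \<Longrightarrow> n \<ge> N \<Longrightarrow> rat_padic_abs p (X m - X n) < e"
      using assms unfolding padic_Cauchy_def by blast
    have "dist (rat_padic_abs p (X m)) (rat_padic_abs p (X n)) < e"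
      if "m \<ge> N" "n \<ge> N" for m n
      using rat_padic_abs_triangle3[OF p, of "X m" "X n"] N[OF that]
      by (simp add: dist_real_def)
    then show "\<exists>M. \<forall>m\<ge>M. \<forall>n\<ge>M. dist (rat_padic_abs p (X m)) (rat_padic_abs p (X n)) < e"
      by blast
  qed
  then show ?thesis by (simp add: Cauchy_convergent_iff)
qed

lemma padic_Cauchy_lim:
  assumes "padic_Cauchy p X"
  shows "(\<lambda>n. rat_padic_abs p (X n)) \<longlonglongrightarrow> lim (\<lambda>n. rat_padic_abs p (X n))"
  using padic_Cauchy_abs[OF assms] by (simp add: convergent_LIMSEQ_iff)

lemma padic_Cauchy_bounded:
  assumes "padic_Cauchy p X"
  obtains B where "B > 0" "\<And>n. rat_padic_abs p (X n) \<le> B"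
proof -
  have "Bseq (\<lambda>n. rat_padic_abs p (X n))"
    using padic_Cauchy_abs[OF assms] by (rule convergent_imp_Bseq)
  then show thesis using that by (elim BseqE) auto
qed

lemma padic_Cauchy_add:
  assumes "padic_Cauchy p X" "padic_Cauchy p Y"
  shows "padic_Cauchy p (\<lambda>n. X n + Y n)"
  unfolding padic_Cauchy_def
proof (intro allI impI)
  fix e :: real assume "e > 0"
  then obtain M N where
    M: "\<And>m n. m \<ge> M \<Longrightarrow> n \<ge> M \<Longrightarrow> rat_padic_abs p (X m - X n) < e" and
    N: "\<And>m n. m \<ge> N \<Longrightarrow> n \<ge> N \<Longrightarrow> rat_padic_abs p (Y m - Y n) < e"
    using assms unfolding padic_Cauchy_def by meson
  have "rat_padic_abs p ((X m + Y m) - (X n + Y n)) < e"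
    if "m \<ge> max M N" "n \<ge> max M N" for m n
    using rat_padic_abs_ultrametric[OF p, of "X m - X n" "Y m - Y n"] M[of m n] N[of m n] that
    by (simp add: algebra_simps)
  then show "\<exists>N. \<forall>m\<ge>N. \<forall>n\<ge>N. rat_padic_abs p ((X m + Y m) - (X n + Y n)) < e"
    by blast
qed

lemma padic_Cauchy_minus:
  assumes "padic_Cauchy p X"
  shows "padic_Cauchy p (\<lambda>n. - X n)"
proof -
  have "rat_padic_abs p (- X m - - X n) = rat_padic_abs p (X m - X n)" for m n
    using rat_padic_abs_minus[OF p, of "X m - X n"] by simp
  then show ?thesis using assms by (simp add: padic_Cauchy_def)
qed

lemma padic_Cauchy_diff:
  assumes "padic_Cauchy p X" "padic_Cauchy p Y"
  shows "padic_Cauchy p (\<lambda>n. X n - Y n)"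
  using padic_Cauchy_add[OF assms(1) padic_Cauchy_minus[OF assms(2)]] by simp

lemma padic_Cauchy_mult:
  assumes X: "padic_Cauchy p X" and Y: "padic_Cauchy p Y"
  shows "padic_Cauchy p (\<lambda>n. X n * Y n)"
proof -
  obtain A where A: "A > 0" "\<And>n. rat_padic_abs p (X n) \<le> A"
    using padic_Cauchy_bounded[OF X] by blast
  obtain B where B: "B > 0" "\<And>n. rat_padic_abs p (Y n) \<le> B"
    using padic_Cauchy_bounded[OF Y] by blast
  show ?thesis unfolding padic_Cauchy_def
  proof (intro allI impI)
    fix e :: real assume e: "e > 0"
    obtain M where M: "\<And>m n. m \<ge> M \<Longrightarrow> n \<ge> M \<Longrightarrow> rat_padic_abs p (X m - X n) < e / B"
      using X e B unfolding padic_Cauchy_def by (meson divide_pos_pos)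
    obtain N where N: "\<And>m n. m \<ge> N \<Longrightarrow> n \<ge> N \<Longrightarrow> rat_padic_abs p (Y m - Y n) < e / A"
      using Y e A unfolding padic_Cauchy_def by (meson divide_pos_pos)
    have "rat_padic_abs p (X m * Y m - X n * Y n) < e"
      if mn: "m \<ge> max M N" "n \<ge> max M N" for m n
    proof -
      have "rat_padic_abs p (X m) * rat_padic_abs p (Y m - Y n) \<le> A * rat_padic_abs p (Y m - Y n)"
        using A by (intro mult_right_mono) auto
      also have "\<dots> < e" using N[of m n] mn A by (simp add: field_simps)
      finally have 1: "rat_padic_abs p (X m * (Y m - Y n)) < e"
        by (simp add: rat_padic_abs_mult[OF p])
      have "rat_padic_abs p (X m - X n) * rat_padic_abs p (Y n) \<le> rat_padic_abs p (X m - X n) * B"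
        using B by (intro mult_left_mono) auto
      also have "\<dots> < e" using M[of m n] mn B by (simp add: field_simps)
      finally have 2: "rat_padic_abs p ((X m - X n) * Y n) < e"
        by (simp add: rat_padic_abs_mult[OF p])
      have "X m * Y m - X n * Y n = X m * (Y m - Y n) + (X m - X n) * Y n"
        by (simp add: algebra_simps)
      then show ?thesis
        using rat_padic_abs_ultrametric[OF p, of "X m * (Y m - Y n)" "(X m - X n) * Y n"] 1 2
        by simp
    qed
    then show "\<exists>N. \<forall>m\<ge>N. \<forall>n\<ge>N. rat_padic_abs p (X m * Y m - X n * Y n) < e"
      by blast
  qed
qed

lemma padic_null_add:
  assumes "padic_null p X" "padic_null p Y"
  shows "padic_null p (\<lambda>n. X n + Y n)"
proof -
  have "(\<lambda>n. rat_padic_abs p (X n) + rat_padic_abs p (Y n)) \<longlonglongrightarrow> 0"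
    using tendsto_add[OF assms[unfolded padic_null_def]] by simp
  then show ?thesis unfolding padic_null_def
    by (rule Lim_null_comparison[rotated])
       (use rat_padic_abs_triangle[OF p] in auto)
qed

lemma padic_null_minus:
  assumes "padic_null p X"
  shows "padic_null p (\<lambda>n. - X n)"
  using assms by (simp add: padic_null_def rat_padic_abs_minus[OF p])

lemma padic_null_Cauchy_mult:
  assumes X: "padic_Cauchy p X" and Y: "padic_null p Y"
  shows "padic_null p (\<lambda>n. X n * Y n)"
  using tendsto_mult[OF padic_Cauchy_lim[OF X] Y[unfolded padic_null_def]]
  by (simp add: padic_null_def rat_padic_abs_mult[OF p])

lemma padic_Cauchy_not_null:
  assumes X: "padic_Cauchy p X" and nn: "\<not> padic_null p X"
  obtains c N where "c > 0" "\<And>n. n \<ge> N \<Longrightarrow> rat_padic_abs p (X n) > c"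
proof -
  let ?l = "lim (\<lambda>n. rat_padic_abs p (X n))"
  have l: "(\<lambda>n. rat_padic_abs p (X n)) \<longlonglongrightarrow> ?l" using padic_Cauchy_lim[OF X] .
  have "?l \<ge> 0" by (rule LIMSEQ_le_const[OF l]) auto
  moreover have "?l \<noteq> 0" using nn l unfolding padic_null_def by metis
  ultimately have pos: "?l > 0" by linarith
  then have "eventually (\<lambda>n. rat_padic_abs p (X n) > ?l / 2) sequentially"
    by (intro order_tendstoD(1)[OF l]) auto
  with pos show thesis using that[of "?l / 2"] unfolding eventually_sequentially by auto
qed

lemma padic_Cauchy_inverse:
  assumes X: "padic_Cauchy p X" and nn: "\<not> padic_null p X"
  shows "padic_Cauchy p (\<lambda>n. inverse (X n))"
proof -
  obtain c K where c: "c > 0" and K: "\<And>n. n \<ge> K \<Longrightarrow> rat_padic_abs p (X n) > c"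
    using padic_Cauchy_not_null[OF X nn] by blast
  show ?thesis unfolding padic_Cauchy_def
  proof (intro allI impI)
    fix e :: real assume e: "e > 0"
    obtain M where M: "\<And>m n. m \<ge> M \<Longrightarrow> n \<ge> M \<Longrightarrow> rat_padic_abs p (X m - X n) < e * (c * c)"
      using X e c unfolding padic_Cauchy_def by (meson mult_pos_pos)
    have "rat_padic_abs p (inverse (X m) - inverse (X n)) < e"
      if mn: "m \<ge> max M K" "n \<ge> max M K" for m n
    proof -
      have gt: "rat_padic_abs p (X m) > c" "rat_padic_abs p (X n) > c" using K mn by auto
      with c have nz: "X m \<noteq> 0" "X n \<noteq> 0" by auto
      let ?r = "rat_padic_abs p (inverse (X m) - inverse (X n))"
      have "X m * X n * (inverse (X m) - inverse (X n)) = X n - X m"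
        using nz by (simp add: field_simps)
      then have "rat_padic_abs p (X m) * rat_padic_abs p (X n) * ?r = rat_padic_abs p (X n - X m)"
        by (metis rat_padic_abs_mult[OF p])
      also have "\<dots> < e * (c * c)" using M[of n m] mn by auto
      finally have "rat_padic_abs p (X m) * rat_padic_abs p (X n) * ?r < e * (c * c)" .
      moreover have "(c * c) * ?r \<le> rat_padic_abs p (X m) * rat_padic_abs p (X n) * ?r"
        using gt c by (intro mult_right_mono mult_mono) auto
      ultimately have "(c * c) * ?r < (c * c) * e" by (simp add: mult.commute)
      then show ?thesis using c by simp
    qed
    then show "\<exists>N. \<forall>m\<ge>N. \<forall>n\<ge>N. rat_padic_abs p (inverse (X m) - inverse (X n)) < e"
      by blast
  qed
qed

lemma padic_null_diff_lim_eq: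
  assumes X: "padic_Cauchy p X" and Y: "padic_Cauchy p Y"
    and XY: "padic_null p (\<lambda>n. X n - Y n)"
  shows "lim (\<lambda>n. rat_padic_abs p (X n)) = lim (\<lambda>n. rat_padic_abs p (Y n))"
proof -
  have "(\<lambda>n. rat_padic_abs p (X n) - rat_padic_abs p (Y n)) \<longlonglongrightarrow> 0"
    by (rule Lim_null_comparison[OF _ XY[unfolded padic_null_def]])
       (use rat_padic_abs_triangle3[OF p] in auto)
  then have "lim (\<lambda>n. rat_padic_abs p (X n)) - lim (\<lambda>n. rat_padic_abs p (Y n)) = 0"
    using LIMSEQ_unique tendsto_diff[OF padic_Cauchy_lim[OF X] padic_Cauchy_lim[OF Y]]
    by blast
  then show ?thesis by simp
qed

end

text \<open>The prime is the cardinality of the type parameter.\<close>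

typedef (overloaded) ('p :: prime_card) padic_seq = "{X. padic_Cauchy CARD('p) X}"
  morphisms seq Abs_padic_seq
  using padic_Cauchy_const by auto

setup_lifting type_definition_padic_seq

lemma padic_Cauchy_seq: "padic_Cauchy CARD('p) (seq (x :: 'p :: prime_card padic_seq))"
  using seq[of x] by simp

instantiation padic_seq :: (prime_card) comm_ring_1
begin

lift_definition zero_padic_seq :: "'a padic_seq" is "\<lambda>_. 0"
  by (rule padic_Cauchy_const)
lift_definition one_padic_seq :: "'a padic_seq" is "\<lambda>_. 1"
  by (rule padic_Cauchy_const)
lift_definition plus_padic_seq :: "'a padic_seq \<Rightarrow> 'a padic_seq \<Rightarrow> 'a padic_seq"
  is "\<lambda>X Y n. X n + Y n"
  by (rule padic_Cauchy_add[OF prime_card])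
lift_definition minus_padic_seq :: "'a padic_seq \<Rightarrow> 'a padic_seq \<Rightarrow> 'a padic_seq"
  is "\<lambda>X Y n. X n - Y n"
  by (rule padic_Cauchy_diff[OF prime_card])
lift_definition uminus_padic_seq :: "'a padic_seq \<Rightarrow> 'a padic_seq" is "\<lambda>X n. - X n"
  by (rule padic_Cauchy_minus[OF prime_card])
lift_definition times_padic_seq :: "'a padic_seq \<Rightarrow> 'a padic_seq \<Rightarrow> 'a padic_seq"
  is "\<lambda>X Y n. X n * Y n"
  by (rule padic_Cauchy_mult[OF prime_card])

instance
  by standard (transfer; simp add: algebra_simps fun_eq_iff)+

end

definition padic_rel :: "'p :: prime_card padic_seq \<Rightarrow> 'p padic_seq \<Rightarrow> bool" where
  "padic_rel x y \<longleftrightarrow> padic_null CARD('p) (\<lambda>n. seq x n - seq y n)"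

quotient_type (overloaded) 'p padic = "'p :: prime_card padic_seq" / padic_rel
proof (rule equivpI)
  show "reflp (padic_rel :: 'p padic_seq \<Rightarrow> _)"
    by (auto simp: reflp_def padic_rel_def padic_null_0)
  show "symp (padic_rel :: 'p padic_seq \<Rightarrow> _)"
    by (auto simp: symp_def padic_rel_def dest: padic_null_minus[OF prime_card])
  show "transp (padic_rel :: 'p padic_seq \<Rightarrow> _)"
    by (auto simp: transp_def padic_rel_def dest: padic_null_add[OF prime_card])
qed

lift_definition padic_seq_inverse :: "'a :: prime_card padic_seq \<Rightarrow> 'a padic_seq"
  is "\<lambda>X. if padic_null CARD('a) X then (\<lambda>_. 0) else (\<lambda>n. inverse (X n))"
  by (auto intro: padic_Cauchy_const padic_Cauchy_inverse[OF prime_card])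

lemma padic_seq_inverse_mult:
  assumes "\<not> padic_rel x (0 :: 'a :: prime_card padic_seq)"
  shows "padic_rel (padic_seq_inverse x * x) 1"
proof -
  have nn: "\<not> padic_null CARD('a) (seq x)"
    using assms by (simp add: padic_rel_def zero_padic_seq.rep_eq)
  obtain c N where c: "c > 0" and N: "\<And>n. n \<ge> N \<Longrightarrow> rat_padic_abs CARD('a) (seq x n) > c"
    using padic_Cauchy_not_null[OF prime_card padic_Cauchy_seq nn] by blast
  have "seq x n \<noteq> 0" if "n \<ge> N" for n using N[OF that] c by auto
  then have "eventually (\<lambda>n. rat_padic_abs CARD('a) (inverse (seq x n) * seq x n - 1) = 0) sequentially"
    unfolding eventually_sequentially by (intro exI[of _ N]) auto
  then have "(\<lambda>n. rat_padic_abs CARD('a) (inverse (seq x n) * seq x n - 1)) \<longlonglongrightarrow> 0"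
    by (rule tendsto_eventually)
  then show ?thesis
    using nn by (simp add: padic_rel_def padic_null_def times_padic_seq.rep_eq
        one_padic_seq.rep_eq padic_seq_inverse.rep_eq)
qed

lemma padic_rel_simps:
  "padic_rel x x"
  "padic_rel x y \<Longrightarrow> padic_rel y x"
  "padic_rel x y \<Longrightarrow> padic_rel y z \<Longrightarrow> padic_rel x z"
  using padic_equivp by (metis equivp_reflp, metis equivp_symp, metis equivp_transp)

lemma padic_exhaust:
  obtains y where "x = abs_padic y"
  using padic.abs_induct[of "\<lambda>x. \<exists>y. x = abs_padic y" x] by blast

instantiation padic :: (prime_card) field
begin

lift_definition zero_padic :: "'a padic" is 0 .
lift_definition one_padic :: "'a padic" is 1 .
lift_definition plus_padic :: "'a padic \<Rightarrow> 'a padic \<Rightarrow> 'a padic" is "(+)"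
  unfolding padic_rel_def plus_padic_seq.rep_eq
  by (drule (1) padic_null_add[OF prime_card]) (simp add: algebra_simps)
lift_definition minus_padic :: "'a padic \<Rightarrow> 'a padic \<Rightarrow> 'a padic" is "(-)"
  unfolding padic_rel_def minus_padic_seq.rep_eq
  by (drule padic_null_minus[OF prime_card], drule (1) padic_null_add[OF prime_card], drule padic_null_minus[OF prime_card]) (simp add: algebra_simps)
lift_definition uminus_padic :: "'a padic \<Rightarrow> 'a padic" is uminus
  unfolding padic_rel_def uminus_padic_seq.rep_eq
  by (drule padic_null_minus[OF prime_card]) (simp add: algebra_simps)
lift_definition times_padic :: "'a padic \<Rightarrow> 'a padic \<Rightarrow> 'a padic" is "(*)"
proof -
  fix a b c d :: "'a padic_seq"
  assume "padic_rel a b" "padic_rel c d"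
  then have "padic_null CARD('a) (\<lambda>n. seq a n * (seq c n - seq d n) + seq d n * (seq a n - seq b n))"
    unfolding padic_rel_def
    by (intro padic_null_add[OF prime_card] padic_null_Cauchy_mult[OF prime_card] padic_Cauchy_seq)
  then show "padic_rel (a * c) (b * d)"
    by (simp add: padic_rel_def times_padic_seq.rep_eq algebra_simps)
qed

lemma padic_rel_mult:
  "padic_rel a b \<Longrightarrow> padic_rel c d \<Longrightarrow> padic_rel (a * c) (b * (d :: 'a padic_seq))"
  using times_padic.rsp by (auto simp: rel_fun_def)

lift_definition inverse_padic :: "'a padic \<Rightarrow> 'a padic" is padic_seq_inverse
proof -
  fix x y :: "'a padic_seq"
  assume xy: "padic_rel x y"
  let ?i = "padic_seq_inverse :: 'a padic_seq \<Rightarrow> 'a padic_seq"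
  show "padic_rel (?i x) (?i y)"
  proof (cases "padic_rel x 0")
    case True
    then have "padic_rel y 0" using xy padic_rel_simps by blast
    with True have "padic_null CARD('a) (seq x)" "padic_null CARD('a) (seq y)"
      by (simp_all add: padic_rel_def zero_padic_seq.rep_eq)
    then have "?i x = ?i y"
      by (simp add: padic_seq_inverse.rep_eq flip: seq_inject)
    then show ?thesis by (simp add: padic_rel_simps)
  next
    case False
    then have Fy: "\<not> padic_rel y 0" using xy padic_rel_simps by blast
    have 1: "padic_rel (?i x * (?i y * y)) (?i x * 1)"
      by (intro padic_rel_mult padic_rel_simps(1) padic_seq_inverse_mult Fy)
    have 2: "padic_rel (?i y * (?i x * x)) (?i y * 1)"
      by (intro padic_rel_mult padic_rel_simps(1) padic_seq_inverse_mult False)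
    have 3: "padic_rel ((?i x * ?i y) * x) ((?i x * ?i y) * y)"
      by (intro padic_rel_mult padic_rel_simps(1) xy)
    show ?thesis
      using 1 2 3 padic_rel_simps(2,3) by (simp add: mult_ac) blast
  qed
qed

definition divide_padic :: "'a padic \<Rightarrow> 'a padic \<Rightarrow> 'a padic" where
  "divide_padic x y = x * inverse y"

instance
proof
  fix a b c :: "'a padic"
  show "a * b * c = a * (b * c)" by transfer (simp add: mult.assoc padic_rel_simps)
  show "a * b = b * a" by transfer (simp add: mult.commute padic_rel_simps)
  show "1 * a = a" by transfer (simp add: padic_rel_simps)
  show "a + b + c = a + (b + c)" by transfer (simp add: add.assoc padic_rel_simps)
  show "a + b = b + a" by transfer (simp add: add.commute padic_rel_simps)
  show "0 + a = a" by transfer (simp add: padic_rel_simps)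
  show "- a + a = 0" by transfer (simp add: padic_rel_simps)
  show "a - b = a + - b" by transfer (simp add: padic_rel_simps)
  show "(a + b) * c = a * c + b * c" by transfer (simp add: distrib_right padic_rel_simps)
  show "(0 :: 'a padic) \<noteq> 1"
    by transfer (simp add: padic_rel_def padic_null_def zero_padic_seq.rep_eq
        one_padic_seq.rep_eq prime_card tendsto_const_iff)
  show "a \<noteq> 0 \<Longrightarrow> inverse a * a = 1"
    by transfer (rule padic_seq_inverse_mult)
  show "a div b = a * inverse b" by (rule divide_padic_def)
  show "inverse (0 :: 'a padic) = 0"
  proof transfer
    have "padic_seq_inverse (0 :: 'a padic_seq) = 0"
      by (simp add: padic_seq_inverse.rep_eq zero_padic_seq.rep_eq padic_null_0 flip: seq_inject)
    then show "padic_rel (padic_seq_inverse 0) (0 :: 'a padic_seq)"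
      by (simp add: padic_rel_simps)
  qed
qed

end

subsection \<open>Absolute value and metric topology\<close>

lift_definition padic_norm :: "'a :: prime_card padic \<Rightarrow> real"
  is "\<lambda>x. lim (\<lambda>n. rat_padic_abs CARD('a) (seq x n))"
  unfolding padic_rel_def by (rule padic_null_diff_lim_eq[OF prime_card padic_Cauchy_seq padic_Cauchy_seq])

lemma padic_norm_LIMSEQ:
  "(\<lambda>n. rat_padic_abs CARD('a) (seq x n)) \<longlonglongrightarrow> padic_norm (abs_padic (x :: 'a :: prime_card padic_seq))"
  by (simp add: padic_norm.abs_eq padic_Cauchy_lim[OF prime_card padic_Cauchy_seq])

lemma padic_norm_eq_0: "padic_norm x = 0 \<longleftrightarrow> x = 0" for x :: "'a :: prime_card padic"
proof -
  obtain y where x: "x = abs_padic y" by (rule padic_exhaust)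
  have "abs_padic y = (0 :: 'a padic) \<longleftrightarrow> padic_rel y 0"
    by (simp add: zero_padic_def padic.abs_eq_iff)
  also have "\<dots> \<longleftrightarrow> (\<lambda>n. rat_padic_abs CARD('a) (seq y n)) \<longlonglongrightarrow> 0"
    by (simp add: padic_rel_def padic_null_def zero_padic_seq.rep_eq)
  also have "\<dots> \<longleftrightarrow> padic_norm (abs_padic y) = 0"
    using padic_norm_LIMSEQ[of y] LIMSEQ_unique by metis
  finally show ?thesis by (simp add: x)
qed

lemma padic_norm_triangle: "padic_norm (x + y) \<le> padic_norm x + padic_norm y" for x y :: "'a :: prime_card padic"
proof -
  obtain a b where x: "x = abs_padic a" and y: "y = abs_padic b"
    by (metis padic_exhaust)
  have "padic_norm (abs_padic (a + b)) \<le> padic_norm (abs_padic a) + padic_norm (abs_padic b)"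
    by (rule LIMSEQ_le[OF padic_norm_LIMSEQ tendsto_add[OF padic_norm_LIMSEQ padic_norm_LIMSEQ]])
       (simp add: plus_padic_seq.rep_eq rat_padic_abs_triangle[OF prime_card])
  then show ?thesis by (simp add: x y plus_padic.abs_eq)
qed

lemma padic_norm_minus: "padic_norm (- x) = padic_norm x" for x :: "'a :: prime_card padic"
  by transfer (simp add: uminus_padic_seq.rep_eq rat_padic_abs_minus[OF prime_card])

instantiation padic :: (prime_card) metric_space
begin

definition dist_padic :: "'a padic \<Rightarrow> 'a padic \<Rightarrow> real" where
  "dist_padic x y = padic_norm (x - y)"

definition uniformity_padic :: "('a padic \<times> 'a padic) filter" where
  "uniformity_padic = (INF e\<in>{0 <..}. principal {(x, y). dist x y < e})"

definition open_padic :: "'a padic set \<Rightarrow> bool" where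
  "open_padic U = (\<forall>x\<in>U. eventually (\<lambda>(x', y). x' = x \<longrightarrow> y \<in> U) uniformity)"

instance
proof
  fix x y z :: "'a padic"
  show "dist x y = 0 \<longleftrightarrow> x = y"
    by (simp add: dist_padic_def padic_norm_eq_0)
  have "padic_norm (x - y) \<le> padic_norm (x - z) + padic_norm (z - y)"
    using padic_norm_triangle[of "x - z" "z - y"] by simp
  also have "padic_norm (z - y) = padic_norm (y - z)"
    using padic_norm_minus[of "y - z"] by simp
  finally show "dist x y \<le> dist x z + dist y z"
    by (simp add: dist_padic_def)
qed (rule uniformity_padic_def open_padic_def)+

end

section \<open>Haar measure on finite powers of the p-adic field\<close>

text \<open>
  The power indexed by a finite set \<open>I\<close> is the set \<open>I \<rightarrow>\<^sub>E UNIV\<close> of extensional functions.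
  As the p-adic field is second countable, the Borel sets of the power are those of the
  product measurable space.
\<close>

definition is_haar_measure :: "'i set \<Rightarrow> ('i \<Rightarrow> 'p :: prime_card padic) measure \<Rightarrow> bool" where
  "is_haar_measure I M \<longleftrightarrow>
     sets M = sets (\<Pi>\<^sub>M i\<in>I. (borel :: 'p padic measure)) \<and>
     (\<forall>v \<in> I \<rightarrow>\<^sub>E UNIV. \<forall>A \<in> sets M.
        emeasure M ((\<lambda>x. \<lambda>i\<in>I. v i + x i) ` A) = emeasure M A) \<and>
     emeasure M (I \<rightarrow>\<^sub>E {x. padic_norm x \<le> 1}) = 1"

text \<open>For finite \<open>I\<close> there is exactly one such measure, so nothing depends on the choice.\<close>

definition haar_measure :: "'i set \<Rightarrow> ('i \<Rightarrow> 'p :: prime_card padic) measure" where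
  "haar_measure I = (SOME M. is_haar_measure I M)"

section \<open>Projective space\<close>

text \<open>
  A projective space has its homogeneous coordinates indexed by a nonempty finite set \<open>I\<close>,
  so that its dimension is \<open>card I - 1\<close>; a point is the set of all its coordinate vectors.
\<close>

definition max_norm :: "'i set \<Rightarrow> ('i \<Rightarrow> 'p :: prime_card padic) \<Rightarrow> real" where
  "max_norm I a = (MAX i\<in>I. padic_norm (a i))"

definition unit_sphere :: "'i set \<Rightarrow> ('i \<Rightarrow> 'p :: prime_card padic) set" where
  "unit_sphere I = {a \<in> I \<rightarrow>\<^sub>E UNIV. max_norm I a = 1}"

definition proj_point ::
    "'i set \<Rightarrow> ('i \<Rightarrow> 'p :: prime_card padic) \<Rightarrow> ('i \<Rightarrow> 'p padic) set" where
  "proj_point I a = {\<lambda>i\<in>I. c * a i | c. c \<noteq> 0}"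

definition proj_space :: "'i set \<Rightarrow> ('i \<Rightarrow> 'p :: prime_card padic) set set" where
  "proj_space I = proj_point I ` {a \<in> I \<rightarrow>\<^sub>E UNIV. \<exists>i\<in>I. a i \<noteq> 0}"

definition wedge_norm ::
    "'i set \<Rightarrow> ('i \<Rightarrow> 'p :: prime_card padic) \<Rightarrow> ('i \<Rightarrow> 'p padic) \<Rightarrow> real" where
  "wedge_norm I a b = (MAX (i, j)\<in>I \<times> I. padic_norm (a i * b j - a j * b i))"

definition sphere_rep ::
    "'i set \<Rightarrow> ('i \<Rightarrow> 'p :: prime_card padic) set \<Rightarrow> ('i \<Rightarrow> 'p padic)" where
  "sphere_rep I x = (SOME a. a \<in> unit_sphere I \<and> proj_point I a = x)"

text \<open>Two representatives on the sphere differ by a unit, which does not affect the minors' norm.\<close>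

definition proj_dist ::
    "'i set \<Rightarrow> ('i \<Rightarrow> 'p :: prime_card padic) set \<Rightarrow> ('i \<Rightarrow> 'p padic) set \<Rightarrow> real" where
  "proj_dist I x y = wedge_norm I (sphere_rep I x) (sphere_rep I y)"

definition proj_ball ::
    "'i set \<Rightarrow> ('i \<Rightarrow> 'p :: prime_card padic) set \<Rightarrow> real \<Rightarrow> ('i \<Rightarrow> 'p padic) set set" where
  "proj_ball I x r = {y \<in> proj_space I. proj_dist I x y \<le> r}"

definition proj_measure :: "'i set \<Rightarrow> ('i \<Rightarrow> 'p :: prime_card padic) set set \<Rightarrow> real" where
  "proj_measure I U =
     1 / (1 - 1 / real CARD('p)) * measure (haar_measure I) {a \<in> unit_sphere I. proj_point I a \<in> U}"

text \<open>
  The \<open>k\<close>-dimensional volume of an algebraic subset \<open>Y\<close> of dimension \<open>k\<close>;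
  the exponent is \<open>m * (N - k)\<close> for \<open>N = card I - 1\<close>.
\<close>

definition proj_vol :: "'i set \<Rightarrow> nat \<Rightarrow> ('i \<Rightarrow> 'p :: prime_card padic) set set \<Rightarrow> real" where
  "proj_vol I k Y =
     lim (\<lambda>m. real CARD('p) powi (int m * (int (card I) - 1 - int k)) *
              proj_measure I (\<Union>x\<in>Y. proj_ball I x (1 / real CARD('p) ^ m)))"

section \<open>The Veronese map\<close>

definition multi_indices :: "nat \<Rightarrow> nat \<Rightarrow> (nat \<Rightarrow> nat) set" where
  "multi_indices n d = {\<alpha> \<in> {0..n} \<rightarrow>\<^sub>E UNIV. (\<Sum>i = 0..n. \<alpha> i) = d}"

lemma card_multi_indices: "card (multi_indices n d) = (n + d) choose d"
proof -
  have "bij_betw (\<lambda>\<alpha>. map \<alpha> [0..<Suc n]) (multi_indices n d)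
          {l. length l = Suc n \<and> sum_list l = d}"
  proof (rule bij_betw_byWitness[where f' = "\<lambda>l. \<lambda>i\<in>{0..n}. l ! i"])
    show "\<forall>\<alpha>\<in>multi_indices n d. (\<lambda>i\<in>{0..n}. map \<alpha> [0..<Suc n] ! i) = \<alpha>"
    proof (intro ballI ext)
      fix \<alpha> i assume "\<alpha> \<in> multi_indices n d"
      then show "(\<lambda>i\<in>{0..n}. map \<alpha> [0..<Suc n] ! i) i = \<alpha> i"
        by (auto simp: multi_indices_def restrict_def PiE_def extensional_def simp del: upt_Suc)
    qed
    show "\<forall>l\<in>{l. length l = Suc n \<and> sum_list l = d}.
        map (\<lambda>i\<in>{0..n}. l ! i) [0..<Suc n] = l"
      by (auto intro!: nth_equalityI simp del: upt_Suc)
    show "(\<lambda>\<alpha>. map \<alpha> [0..<Suc n]) ` multi_indices n d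
        \<subseteq> {l. length l = Suc n \<and> sum_list l = d}"
      by (auto simp: multi_indices_def interv_sum_list_conv_sum_set_nat atLeastLessThanSuc_atLeastAtMost
               simp del: upt_Suc)
    show "(\<lambda>l. \<lambda>i\<in>{0..n}. l ! i) ` {l. length l = Suc n \<and> sum_list l = d}
        \<subseteq> multi_indices n d"
      by (auto simp: multi_indices_def sum_list_sum_nth atLeastLessThanSuc_atLeastAtMost)
  qed
  then have "card (multi_indices n d) = card {l :: nat list. length l = Suc n \<and> sum_list l = d}"
    by (rule bij_betw_same_card)
  then show ?thesis by (simp add: card_length_sum_list add.commute)
qed

definition monomial_vector :: "nat \<Rightarrow> nat \<Rightarrow> (nat \<Rightarrow> 'p :: prime_card padic) \<Rightarrow> (nat \<Rightarrow> nat) \<Rightarrow> 'p padic" where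
  "monomial_vector n d a = (\<lambda>\<alpha>\<in>multi_indices n d. \<Prod>i = 0..n. a i ^ \<alpha> i)"

text \<open>By homogeneity the value does not depend on the chosen coordinate vector of \<open>x\<close>.\<close>

definition veronese ::
    "nat \<Rightarrow> nat \<Rightarrow> (nat \<Rightarrow> 'p :: prime_card padic) set \<Rightarrow> ((nat \<Rightarrow> nat) \<Rightarrow> 'p padic) set" where
  "veronese n d x = proj_point (multi_indices n d) (monomial_vector n d (SOME a. a \<in> x))"

end

theory Submission
  imports Defs
begin

text \<open>
The Veronese map is an isometry at small scales, and in projective space over the p-adic numbers
this already determines volumes.  Fix \<open>m \<ge> 1\<close> and let \<open>r\<close> be the \<open>m\<close>-th power of \<open>1/p\<close>.  By the
ultrametric inequality two balls of radius \<open>r\<close> are equal or disjoint, so the tube of radius \<open>r\<close>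
around a set \<open>Y\<close> is a finite disjoint union of balls.  By translation invariance of Haar measure
each ball of radius \<open>r\<close> in a projective space of dimension \<open>N\<close> has measure \<open>r ^ N\<close>.  Hence the
normalised tube volume of \<open>Y\<close> is the number of balls of radius \<open>r\<close> with centre in \<open>Y\<close> times
\<open>r ^ n\<close>, whatever \<open>N\<close> is (\<open>proj_measure_tube\<close>).  Since the Veronese map identifies the balls
of radius \<open>r\<close> centred in projective \<open>n\<close>-space with the balls of radius \<open>r\<close> centred in its image,
both tube volumes agree for every \<open>m \<ge> 1\<close>, and so do their limits.

The metric is easiest to handle on the unit sphere.  For \<open>r < 1\<close>, two points of the sphere have
projective distance at most \<open>r\<close> iff, after multiplying one of them by a unit, they differ by at most \<open>r\<close>
in every coordinate (\<open>wedge_norm_le_iff_unit_close\<close>).  This makes closeness an equivalence relation,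
describes the cone over a ball as a disjoint union of translates of a polydisc, and reduces the
isometry property to monomials (\<open>unit_close_monomial_vector_iff\<close>): products of integral elements
preserve congruences, and conversely the monomials \<open>x\<^sub>i ^ (d - 1) * x\<^sub>j\<close>, with \<open>x\<^sub>i\<close> a unit, recover
the coordinates \<open>x\<^sub>j\<close> up to a common unit.

Since Haar measure enters through a choice operator, its existence has to be established before its
invariance can be used.  The one-dimensional measure is the image of Lebesgue measure on the
nonnegative reals under the Monna map, which reflects base-\<open>p\<close> expansions at the radix point;
balls pull back to intervals of the right length (\<open>monna_vimage_ball\<close>).  Powers of the field
carry the product measure (\<open>haar_measure_exists\<close>).
\<close>

section \<open>The absolute value is multiplicative and ultrametric\<close>

lemma padic_norm_nonneg [simp]: "padic_norm (x :: 'p :: prime_card padic) \<ge> 0"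
proof -
  obtain y where x: "x = abs_padic y" by (rule padic_exhaust)
  show ?thesis unfolding x by (rule LIMSEQ_le_const[OF padic_norm_LIMSEQ]) auto
qed

lemma padic_norm_zero [simp]: "padic_norm (0 :: 'p :: prime_card padic) = 0"
  by (simp add: padic_norm_eq_0)

lemma padic_norm_mult:
  "padic_norm (x * y) = padic_norm x * padic_norm (y :: 'p :: prime_card padic)"
proof -
  obtain a b where x: "x = abs_padic a" and y: "y = abs_padic b"
    by (metis padic_exhaust)
  have "padic_norm (abs_padic (a * b)) = padic_norm (abs_padic a) * padic_norm (abs_padic b)"
    by (rule LIMSEQ_unique[OF padic_norm_LIMSEQ])
       (use tendsto_mult[OF padic_norm_LIMSEQ padic_norm_LIMSEQ, of a b] in
        \<open>simp add: times_padic_seq.rep_eq rat_padic_abs_mult[OF prime_card]\<close>)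
  then show ?thesis by (simp add: x y times_padic.abs_eq)
qed

lemma padic_norm_ultrametric:
  "padic_norm (x + y) \<le> max (padic_norm x) (padic_norm (y :: 'p :: prime_card padic))"
proof -
  obtain a b where x: "x = abs_padic a" and y: "y = abs_padic b"
    by (metis padic_exhaust)
  have "padic_norm (abs_padic (a + b)) \<le> max (padic_norm (abs_padic a)) (padic_norm (abs_padic b))"
    by (rule LIMSEQ_le[OF padic_norm_LIMSEQ tendsto_max[OF padic_norm_LIMSEQ padic_norm_LIMSEQ]])
       (simp add: plus_padic_seq.rep_eq rat_padic_abs_ultrametric[OF prime_card])
  then show ?thesis by (simp add: x y plus_padic.abs_eq)
qed

lemma padic_norm_add_le:
  "padic_norm x \<le> r \<Longrightarrow> padic_norm y \<le> r \<Longrightarrow> padic_norm (x + y :: 'p :: prime_card padic) \<le> r"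
  using padic_norm_ultrametric[of x y] by linarith

lemma padic_norm_diff_le:
  "padic_norm x \<le> r \<Longrightarrow> padic_norm y \<le> r \<Longrightarrow> padic_norm (x - y :: 'p :: prime_card padic) \<le> r"
  using padic_norm_add_le[of x r "- y"] by (simp add: padic_norm_minus)

lemma padic_norm_diff_commute:
  "padic_norm (x - y) = padic_norm (y - x :: 'p :: prime_card padic)"
  using padic_norm_minus[of "x - y"] by simp

lemma padic_norm_diff_trans:
  assumes "padic_norm (x - y) \<le> r" "padic_norm (y - z) \<le> r"
  shows "padic_norm (x - z :: 'p :: prime_card padic) \<le> r"
  using padic_norm_add_le[OF assms] by simp

lemma padic_norm_one [simp]: "padic_norm (1 :: 'p :: prime_card padic) = 1"
proof -
  have "padic_norm (1 :: 'p padic) * padic_norm (1 :: 'p padic) = padic_norm (1 :: 'p padic)"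
    by (simp flip: padic_norm_mult)
  moreover have "padic_norm (1 :: 'p padic) \<noteq> 0" by (simp add: padic_norm_eq_0)
  ultimately show ?thesis by simp
qed

lemma padic_norm_inverse:
  "padic_norm (inverse x) = inverse (padic_norm (x :: 'p :: prime_card padic))"
proof (cases "x = 0")
  case False
  then have "padic_norm x * padic_norm (inverse x) = 1" by (simp flip: padic_norm_mult)
  then show ?thesis by (metis inverse_unique)
qed auto

lemma padic_norm_divide:
  "padic_norm (x / y) = padic_norm x / padic_norm (y :: 'p :: prime_card padic)"
  by (simp add: divide_inverse padic_norm_mult padic_norm_inverse)

lemma padic_norm_power: "padic_norm (x ^ k) = padic_norm (x :: 'p :: prime_card padic) ^ k"
  by (induction k) (auto simp: padic_norm_mult)

text \<open>
In an ultrametric triangle the two longest sides have equal length.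
\<close>
lemma padic_norm_eq_of_close:
  assumes "padic_norm (x - y) < padic_norm (x :: 'p :: prime_card padic)"
  shows "padic_norm y = padic_norm x"
proof -
  have "padic_norm y \<le> max (padic_norm x) (padic_norm (x - y))"
    using padic_norm_ultrametric[of x "y - x"] by (simp add: padic_norm_diff_commute)
  moreover have "padic_norm x \<le> max (padic_norm y) (padic_norm (x - y))"
    using padic_norm_ultrametric[of y "x - y"] by simp
  ultimately show ?thesis using assms by linarith
qed

section \<open>Density of the rational numbers\<close>

definition padic_of_rat :: "rat \<Rightarrow> 'p :: prime_card padic" where
  "padic_of_rat q = abs_padic (Abs_padic_seq (\<lambda>_. q))"

lemma seq_const [simp]: "seq (Abs_padic_seq (\<lambda>_. q)) = (\<lambda>_. q)"
  by (simp add: Abs_padic_seq_inverse padic_Cauchy_const)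

lemma padic_of_rat_add: "padic_of_rat (a + b) = (padic_of_rat a + padic_of_rat b :: 'p :: prime_card padic)"
  unfolding padic_of_rat_def plus_padic.abs_eq
  by (rule arg_cong[of _ _ abs_padic]) (simp add: plus_padic_seq.rep_eq flip: seq_inject)

lemma padic_of_rat_diff: "padic_of_rat (a - b) = (padic_of_rat a - padic_of_rat b :: 'p :: prime_card padic)"
  using padic_of_rat_add[of "a - b" b, where 'p = 'p] by (simp add: eq_diff_eq)

lemma padic_of_rat_mult: "padic_of_rat (a * b) = (padic_of_rat a * padic_of_rat b :: 'p :: prime_card padic)"
  unfolding padic_of_rat_def times_padic.abs_eq
  by (rule arg_cong[of _ _ abs_padic]) (simp add: times_padic_seq.rep_eq flip: seq_inject)

lemma padic_of_rat_1 [simp]: "padic_of_rat 1 = (1 :: 'p :: prime_card padic)"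
  unfolding padic_of_rat_def one_padic_def
  by (rule arg_cong[of _ _ abs_padic]) (simp add: one_padic_seq.rep_eq flip: seq_inject)

lemma padic_of_rat_0 [simp]: "padic_of_rat 0 = (0 :: 'p :: prime_card padic)"
  using padic_of_rat_diff[of 1 1] by simp

lemma padic_of_rat_of_nat [simp]: "padic_of_rat (of_nat k) = (of_nat k :: 'p :: prime_card padic)"
  by (induction k) (auto simp: padic_of_rat_add)

lemma padic_norm_of_rat [simp]:
  "padic_norm (padic_of_rat q :: 'p :: prime_card padic) = rat_padic_abs CARD('p) q"
  using LIMSEQ_unique[OF padic_norm_LIMSEQ[of "Abs_padic_seq (\<lambda>_. q) :: 'p padic_seq"]]
  by (simp add: padic_of_rat_def)

text \<open>
The absolute value is a limit along representing Cauchy sequences, so closed bounds on all late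
terms pass to the quotient.
\<close>
lemma padic_norm_limit_diff_le:
  fixes X :: "nat \<Rightarrow> rat"
  assumes X: "padic_Cauchy CARD('p :: prime_card) X"
    and le: "\<And>k. k \<ge> n \<Longrightarrow> rat_padic_abs CARD('p) (X k - q) \<le> r"
  shows "padic_norm (abs_padic (Abs_padic_seq X) - padic_of_rat q :: 'p padic) \<le> r"
proof -
  let ?s = "Abs_padic_seq X - Abs_padic_seq (\<lambda>_. q) :: 'p padic_seq"
  have s: "seq ?s = (\<lambda>k. X k - q)"
    using X by (simp add: minus_padic_seq.rep_eq Abs_padic_seq_inverse)
  have "padic_norm (abs_padic ?s) \<le> r"
    by (rule LIMSEQ_le_const2[OF padic_norm_LIMSEQ]) (use le s in auto)
  then show ?thesis by (simp add: padic_of_rat_def minus_padic.abs_eq)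
qed

lemma padic_of_rat_dense:
  assumes "e > 0"
  obtains q where "padic_norm (x - padic_of_rat q :: 'p :: prime_card padic) \<le> e"
proof -
  obtain y where x: "x = abs_padic y" by (rule padic_exhaust)
  obtain N where N: "\<And>m n. m \<ge> N \<Longrightarrow> n \<ge> N \<Longrightarrow> rat_padic_abs CARD('p) (seq y m - seq y n) < e"
    using padic_Cauchy_seq[of y] assms unfolding padic_Cauchy_def by meson
  have "padic_norm (abs_padic (Abs_padic_seq (seq y)) - padic_of_rat (seq y N) :: 'p padic) \<le> e"
    by (rule padic_norm_limit_diff_le[where n = N]) (use N padic_Cauchy_seq[of y] in \<open>auto intro: less_imp_le\<close>)
  then show thesis using that x by (simp add: seq_inverse)
qed

section \<open>Residues modulo powers of the prime\<close>

lemma CARD_gt_1: "CARD('p :: prime_card) > 1"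
  using prime_gt_1_nat[OF prime_card] .

lemma CARD_pos [simp]: "CARD('p :: prime_card) > 0"
  using CARD_gt_1[where 'p = 'p] by linarith

text \<open>
Both sides compare \<open>m\<close> with the multiplicity of \<open>p\<close> in \<open>a\<close>; this is the bridge between distances
and congruences.
\<close>
lemma rat_padic_abs_of_int_le_iff:
  assumes "prime p"
  shows "rat_padic_abs p (of_int a) \<le> 1 / real p ^ m \<longleftrightarrow> int p ^ m dvd a"
proof (cases "a = 0")
  case False
  have p: "real p > 1" using prime_gt_1_nat[OF assms] by simp
  have abs: "rat_padic_abs p (of_int a) = 1 / real p ^ multiplicity (int p) a"
    using rat_padic_abs_divide[OF assms False, of 1] by (simp add: power_int_minus divide_inverse)
  have "rat_padic_abs p (of_int a) \<le> 1 / real p ^ m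
      \<longleftrightarrow> real p ^ m \<le> real p ^ multiplicity (int p) a"
    unfolding abs using p by (simp add: field_simps)
  also have "\<dots> \<longleftrightarrow> m \<le> multiplicity (int p) a"
    using p by simp
  also have "\<dots> \<longleftrightarrow> int p ^ m dvd a"
    using p False by (subst power_dvd_iff_le_multiplicity) auto
  finally show ?thesis .
qed (use assms in auto)

lemma padic_norm_of_nat_diff_le_iff:
  "padic_norm (of_nat a - of_nat b :: 'p :: prime_card padic) \<le> 1 / real CARD('p) ^ m
     \<longleftrightarrow> [a = b] (mod CARD('p) ^ m)"
proof -
  have "(of_nat a - of_nat b :: 'p padic) = padic_of_rat (of_int (int a - int b))"
    by (simp add: padic_of_rat_diff)
  then show ?thesis
    by (simp add: rat_padic_abs_of_int_le_iff[OF prime_card] del: of_int_diff)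
      (simp add: cong_iff_dvd_diff flip: cong_int_iff)
qed

lemma padic_norm_of_nat_le_1: "padic_norm (of_nat a :: 'p :: prime_card padic) \<le> 1"
  using padic_norm_of_nat_diff_le_iff[of a 0 0, where 'p = 'p] by simp

lemma padic_norm_CARD: "padic_norm (of_nat CARD('p) :: 'p :: prime_card padic) = 1 / real CARD('p)"
proof -
  have "multiplicity (int CARD('p)) (int CARD('p)) = 1"
    using prime_card_int[where 'a = 'p] by (intro multiplicity_self) auto
  then have "rat_padic_abs CARD('p) (of_int (int CARD('p)) / of_int 1) = 1 / real CARD('p)"
    by (subst rat_padic_abs_divide[OF prime_card]) (auto simp: power_int_minus divide_inverse)
  then show ?thesis
    using padic_norm_of_rat[of "of_nat CARD('p)", where 'p = 'p] by simp
qed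

lemma padic_norm_of_nat_eq_1_iff:
  "padic_norm (of_nat a :: 'p :: prime_card padic) = 1 \<longleftrightarrow> \<not> CARD('p) dvd a"
proof
  assume "padic_norm (of_nat a :: 'p padic) = 1"
  then show "\<not> CARD('p) dvd a"
    using padic_norm_of_nat_diff_le_iff[of a 0 1, where 'p = 'p] CARD_gt_1[where 'p = 'p]
    by (auto simp: cong_0_iff)
next
  assume a: "\<not> CARD('p) dvd a"
  then have a0: "a \<noteq> 0" by (intro notI) simp
  have "multiplicity (int CARD('p)) (int a) = 0"
    using a by (intro not_dvd_imp_multiplicity_0) auto
  then have "rat_padic_abs CARD('p) (of_int (int a) / of_int 1) = 1"
    using a0 by (subst rat_padic_abs_divide[OF prime_card]) auto
  then show "padic_norm (of_nat a :: 'p padic) = 1"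
    using padic_norm_of_rat[of "of_nat a", where 'p = 'p] by simp
qed

text \<open>
Approximate \<open>z\<close> by a rational number \<open>a / b\<close>.  Integrality forces \<open>b\<close> to be prime to \<open>p\<close>, so \<open>b\<close> is
invertible modulo every power of \<open>p\<close>, and \<open>c\<close> is the residue of \<open>a\<close> times that inverse.
\<close>
lemma padic_residue:
  assumes z: "padic_norm (z :: 'p :: prime_card padic) \<le> 1"
  obtains c where "c < CARD('p) ^ m" "padic_norm (z - of_nat c) \<le> 1 / real CARD('p) ^ m"
proof -
  let ?p = "CARD('p)"
  let ?r = "1 / real ?p ^ m"
  have r: "?r > 0" "?r \<le> 1" using CARD_gt_1[where 'p = 'p] by (auto simp: divide_simps)
  obtain q where q: "padic_norm (z - padic_of_rat q) \<le> ?r"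
    using padic_of_rat_dense[OF r(1)] by blast
  have "padic_norm (padic_of_rat q :: 'p padic) \<le> 1"
    using padic_norm_diff_le[of z 1 "z - padic_of_rat q"] z q r by simp
  then have q1: "rat_padic_abs ?p q \<le> 1" by simp
  obtain a b where ab: "quotient_of q = (a, b)" by force
  have b: "b > 0" "coprime a b" "q = of_int a / of_int b"
    using quotient_of_denom_pos[OF ab] quotient_of_coprime[OF ab] quotient_of_div[OF ab] by auto
  have pi: "prime (int ?p)" by (rule prime_card_int)
  have nb: "\<not> int ?p dvd b"
  proof
    assume pb: "int ?p dvd b"
    then have "\<not> int ?p dvd a" using b pi by (metis coprime_common_divisor not_prime_unit)
    then have a0: "a \<noteq> 0" and ma: "multiplicity (int ?p) a = 0" by (auto intro: not_dvd_imp_multiplicity_0)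
    have "multiplicity (int ?p) b > 0" using pb b pi by (simp add: prime_multiplicity_gt_zero_iff)
    then have "rat_padic_abs ?p q > 1"
      using b a0 ma CARD_gt_1[where 'p = 'p]
      by (simp add: rat_padic_abs_divide[OF prime_card])
    with q1 show False by simp
  qed
  then have "coprime b (int ?p ^ m)" using pi
    by (metis coprime_commute coprime_power_right_iff prime_imp_coprime)
  then obtain b' where b': "[b * b' = 1] (mod int ?p ^ m)"
    using cong_solve_coprime_int by blast
  define c where "c = nat ((a * b') mod int ?p ^ m)"
  have cint: "int c = (a * b') mod int ?p ^ m" by (simp add: c_def)
  have "int c < int (?p ^ m)" unfolding cint by simp
  then have c: "c < ?p ^ m" by linarith
  have "[b * int c = b * (a * b')] (mod int ?p ^ m)"
    unfolding cint by (simp add: cong_def mod_mult_right_eq)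
  also have "[b * (a * b') = a * (b * b')] (mod int ?p ^ m)" by (simp add: ac_simps)
  also have "[a * (b * b') = a * 1] (mod int ?p ^ m)" by (rule cong_scalar_left[OF b'])
  finally have "int ?p ^ m dvd a - b * int c" by (simp add: cong_iff_dvd_diff dvd_diff_commute)
  then have "rat_padic_abs ?p (of_int (a - b * int c)) \<le> ?r"
    by (simp only: rat_padic_abs_of_int_le_iff[OF prime_card])
  moreover have "of_int (a - b * int c) = of_int b * (q - of_nat c)"
    using b by (simp add: field_simps)
  moreover have "rat_padic_abs ?p (of_int b) = 1"
    using rat_padic_abs_divide[OF prime_card[where 'a = 'p], of b 1] b nb by (simp add: not_dvd_imp_multiplicity_0)
  ultimately have "rat_padic_abs ?p (q - of_nat c) \<le> ?r"
    by (simp add: rat_padic_abs_mult[OF prime_card])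
  then have "padic_norm (padic_of_rat (q - of_nat c) :: 'p padic) \<le> ?r" by simp
  then have "padic_norm (padic_of_rat q - of_nat c :: 'p padic) \<le> ?r"
    unfolding padic_of_rat_diff by simp
  with q have "padic_norm (z - of_nat c) \<le> ?r" by (rule padic_norm_diff_trans)
  with c that show thesis by blast
qed

lemma padic_residue_unique:
  assumes "c < CARD('p) ^ m" "c' < CARD('p) ^ m"
    and "padic_norm (of_nat c - of_nat c' :: 'p :: prime_card padic) \<le> 1 / real CARD('p) ^ m"
  shows "c = c'"
  using assms by (simp add: padic_norm_of_nat_diff_le_iff cong_less_modulus_unique_nat)

section \<open>Digit reversal\<close>

text \<open>
The van der Corput radical inverse: the base-\<open>p\<close> digits of \<open>k\<close> are reflected at the radix point.
The values form a system of representatives for the p-adic numbers modulo the p-adic integers, as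
the next lemmas show.
\<close>
fun radical_inverse :: "nat \<Rightarrow> nat \<Rightarrow> rat" where
  "radical_inverse p k =
     (if k = 0 \<or> p \<le> 1 then 0 else (of_nat (k mod p) + radical_inverse p (k div p)) / of_nat p)"

declare radical_inverse.simps [simp del]

lemma radical_inverse_step:
  assumes "p > 1"
  shows "of_nat p * radical_inverse p k = of_nat (k mod p) + radical_inverse p (k div p)"
proof (cases "k = 0")
  case True
  then show ?thesis by (simp add: radical_inverse.simps)
next
  case False
  then show ?thesis using assms by (subst radical_inverse.simps) simp
qed

lemma radical_inverse_step_padic:
  "of_nat CARD('p) * padic_of_rat (radical_inverse CARD('p) k)
     = (of_nat (k mod CARD('p)) + padic_of_rat (radical_inverse CARD('p) (k div CARD('p)))
         :: 'p :: prime_card padic)"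
  using arg_cong[OF radical_inverse_step[OF CARD_gt_1, of k], of "padic_of_rat :: rat \<Rightarrow> 'p padic"]
  by (simp add: padic_of_rat_mult padic_of_rat_add)

text \<open>
Multiplying the difference of two values by \<open>p\<close> exposes the difference of the last digits, which is
an integer; hence the values for \<open>k div p\<close> and \<open>l div p\<close> again differ by a p-adic integer, and
induction applies.  Once these agree, the last digits are congruent modulo \<open>p\<close>, hence equal.
\<close>
lemma radical_inverse_inj:
  assumes "padic_norm (padic_of_rat (radical_inverse CARD('p) k)
             - padic_of_rat (radical_inverse CARD('p) l) :: 'p :: prime_card padic) \<le> 1"
  shows "k = l"
  using assms
proof (induction "k + l" arbitrary: k l rule: less_induct)
  case less
  let ?p = "CARD('p)"
  let ?g = "\<lambda>k. padic_of_rat (radical_inverse ?p k) :: 'p padic"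
  have p: "?p > 1" by (rule CARD_gt_1)
  have e: "of_nat ?p * (?g k - ?g l)
      = (of_nat (k mod ?p) - of_nat (l mod ?p)) + (?g (k div ?p) - ?g (l div ?p))"
    unfolding right_diff_distrib radical_inverse_step_padic by simp
  have "padic_norm (of_nat ?p * (?g k - ?g l)) \<le> 1 / real ?p"
    using less.prems p by (simp add: padic_norm_mult padic_norm_CARD divide_simps)
  then have s: "padic_norm ((of_nat (k mod ?p) - of_nat (l mod ?p)) + (?g (k div ?p) - ?g (l div ?p)))
      \<le> 1 / real ?p"
    unfolding e .
  have d: "padic_norm (of_nat (k mod ?p) - of_nat (l mod ?p) :: 'p padic) \<le> 1"
    by (intro padic_norm_diff_le padic_norm_of_nat_le_1)
  have "1 / real ?p \<le> 1" using p by simp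
  then have g: "padic_norm (?g (k div ?p) - ?g (l div ?p)) \<le> 1"
    using padic_norm_diff_le[OF order_trans[OF s] d] by simp
  have kl: "k div ?p = l div ?p"
  proof (cases "k = 0 \<and> l = 0")
    case False
    then have "k div ?p + l div ?p < k + l"
      using p by (metis add.right_neutral add_0 add_less_le_mono add_le_less_mono div_le_dividend div_less_dividend
          gr_zeroI)
    then show ?thesis using g by (rule less.hyps)
  qed auto
  have "padic_norm (of_nat (k mod ?p) - of_nat (l mod ?p) :: 'p padic) \<le> 1 / real ?p ^ 1"
    using s kl by simp
  then have "k mod ?p = l mod ?p"
    using p by (intro padic_residue_unique[where m = 1]) auto
  with kl show ?case by (metis div_mult_mod_eq)
qed


text \<open>
Induction on the order of the pole of \<open>a\<close>: a representative \<open>k\<close> of \<open>p * a\<close> is extended by one digit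
that corrects the remaining integral error modulo \<open>p\<close>.
\<close>
lemma radical_inverse_residue:
  obtains k where "padic_norm (a - padic_of_rat (radical_inverse CARD('p) k) :: 'p :: prime_card padic) \<le> 1"
proof -
  let ?p = "CARD('p)"
  have p: "?p > 1" by (rule CARD_gt_1)
  have "\<exists>k. padic_norm (a - padic_of_rat (radical_inverse ?p k) :: 'p padic) \<le> 1"
    if "padic_norm a \<le> real ?p ^ j" for j using that
  proof (induction j arbitrary: a)
    case 0
    then show ?case by (intro exI[of _ 0]) (simp add: radical_inverse.simps)
  next
    case (Suc j)
    have "padic_norm (of_nat ?p * a) \<le> real ?p ^ j"
      using Suc.prems p by (simp add: padic_norm_mult padic_norm_CARD divide_simps mult.commute)
    from Suc.IH[OF this] obtain k where
      k: "padic_norm (of_nat ?p * a - padic_of_rat (radical_inverse ?p k) :: 'p padic) \<le> 1" by blast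
    obtain c where c: "c < ?p ^ 1"
      "padic_norm (of_nat ?p * a - padic_of_rat (radical_inverse ?p k) - of_nat c :: 'p padic) \<le> 1 / real ?p ^ 1"
      using padic_residue[OF k, of 1] by blast
    \<comment> \<open>The new last digit \<open>c\<close> becomes the leading digit after reflection.\<close>
    define l where "l = ?p * k + c"
    have l: "l mod ?p = c" "l div ?p = k" using c(1) p by (auto simp: l_def)
    have "of_nat ?p * (a - padic_of_rat (radical_inverse ?p l))
        = of_nat ?p * a - padic_of_rat (radical_inverse ?p k) - (of_nat c :: 'p padic)"
      unfolding right_diff_distrib radical_inverse_step_padic l by simp
    then have "padic_norm (of_nat ?p * (a - padic_of_rat (radical_inverse ?p l)) :: 'p padic) \<le> 1 / real ?p"
      using c(2) by simp
    then have "padic_norm (a - padic_of_rat (radical_inverse ?p l) :: 'p padic) \<le> 1"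
      using p by (simp add: padic_norm_mult padic_norm_CARD divide_simps)
    then show ?case by blast
  qed
  moreover obtain j where "padic_norm a \<le> real ?p ^ j"
    using real_arch_pow[of "real ?p" "padic_norm a"] p by (auto intro: less_imp_le)
  ultimately show thesis using that by blast
qed

section \<open>Balls\<close>

definition padic_ball :: "'p :: prime_card padic \<Rightarrow> nat \<Rightarrow> 'p padic set" where
  "padic_ball a m = {y. padic_norm (y - a) \<le> 1 / real CARD('p) ^ m}"

lemma padic_ball_eq_cball: "padic_ball a m = cball a (1 / real CARD('p) ^ m)" for a :: "'p :: prime_card padic"
  by (auto simp: padic_ball_def dist_padic_def padic_norm_diff_commute)

lemma padic_ball_in_borel [measurable]: "padic_ball a m \<in> sets borel"
  unfolding padic_ball_eq_cball by (intro borel_closed closed_cball)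

lemma padic_ball_center [simp]: "a \<in> padic_ball a m"
  by (simp add: padic_ball_def)

text \<open>
Every point of an ultrametric ball is a centre of it.
\<close>
lemma padic_ball_cong:
  assumes "b \<in> padic_ball a m" shows "padic_ball b m = padic_ball a m"
  using assms padic_norm_diff_trans[of _ b "1 / real CARD('a) ^ m" a]
    padic_norm_diff_trans[of _ a "1 / real CARD('a) ^ m" b]
  by (auto simp: padic_ball_def padic_norm_diff_commute[of b a])

lemma padic_ball_mono: "m \<le> k \<Longrightarrow> padic_ball a k \<subseteq> padic_ball (a :: 'p :: prime_card padic) m"
proof -
  assume "m \<le> k"
  then have "1 / real CARD('p) ^ k \<le> 1 / real CARD('p) ^ m"
    using CARD_gt_1[where 'p = 'p] by (intro divide_left_mono power_increasing) auto
  then show ?thesis by (auto simp: padic_ball_def)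
qed

lemma inverse_power_CARD_less:
  assumes "e > 0" obtains m where "1 / real CARD('p :: prime_card) ^ m < e"
  using real_arch_pow_inv[OF assms, of "1 / real CARD('p)"] CARD_gt_1[where 'p = 'p] that
  by (auto simp: power_one_over)

text \<open>
After scaling by a power of \<open>p\<close>, the balls of radius \<open>1 / p ^ m\<close> are the cosets of the p-adic
integers, so each of them contains exactly one scaled representative.
\<close>
lemma radical_inverse_ball:
  obtains k where "\<And>l. of_nat CARD('p) ^ m * padic_of_rat (radical_inverse CARD('p) l) \<in> padic_ball (a :: 'p :: prime_card padic) m \<longleftrightarrow> l = k"
proof -
  let ?p = "of_nat CARD('p) :: 'p padic"
  let ?g = "\<lambda>l. padic_of_rat (radical_inverse CARD('p) l) :: 'p padic"
  have "padic_norm ?p \<noteq> 0" by (simp add: padic_norm_CARD)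
  then have p: "?p \<noteq> 0" unfolding padic_norm_eq_0 .
  obtain k where k: "padic_norm (a / ?p ^ m - ?g k) \<le> 1"
    by (rule radical_inverse_residue)
  have "?p ^ m * ?g l \<in> padic_ball a m \<longleftrightarrow> l = k" for l
  proof -
    have "?p ^ m * ?g l - a = ?p ^ m * (?g l - a / ?p ^ m)"
      using p by (simp add: right_diff_distrib)
    then have "?p ^ m * ?g l \<in> padic_ball a m \<longleftrightarrow> padic_norm (?g l - a / ?p ^ m) \<le> 1"
      using CARD_gt_1[where 'p = 'p]
      by (simp add: padic_ball_def padic_norm_mult padic_norm_power padic_norm_CARD divide_simps power_one_over)
    also have "\<dots> \<longleftrightarrow> l = k"
      using k padic_norm_diff_trans[of "?g l" "a / ?p ^ m" 1 "?g k"] radical_inverse_inj[of l k, where 'p = 'p]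
      by (auto simp: padic_norm_diff_commute[of "?g l"])
    finally show ?thesis .
  qed
  then show thesis by (rule that)
qed

section \<open>The Monna map\<close>

text \<open>
The base-\<open>p\<close> expansion of \<open>x\<close> truncated \<open>n\<close> places after the radix point and reflected there: digits of weight \<open>p ^ (-i - 1)\<close> receive weight \<open>p ^ i\<close>.
\<close>
definition monna_seq :: "nat \<Rightarrow> real \<Rightarrow> nat \<Rightarrow> rat" where
  "monna_seq p x n = of_nat p ^ n * radical_inverse p (nat \<lfloor>x * real p ^ n\<rfloor>)"

text \<open>
Passing from \<open>n\<close> to \<open>n + 1\<close> adds the next digit of \<open>x\<close>, with weight \<open>p ^ n\<close>.
\<close>
lemma monna_seq_step:
  assumes p: "prime p"
  shows "rat_padic_abs p (monna_seq p x (Suc n) - monna_seq p x n) \<le> 1 / real p ^ n"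
proof -
  let ?K = "\<lambda>n. nat \<lfloor>x * real p ^ n\<rfloor>"
  have p1: "p > 1" by (rule prime_gt_1_nat[OF p])
  have "\<lfloor>x * real p ^ Suc n / real_of_int (int p)\<rfloor> = \<lfloor>x * real p ^ Suc n\<rfloor> div int p"
    by (rule floor_divide_real_eq_div) simp
  then have "?K n = ?K (Suc n) div p"
    using p1 by (simp add: nat_div_distrib' )
  then have "monna_seq p x (Suc n) - monna_seq p x n = of_nat p ^ n * of_nat (?K (Suc n) mod p)"
    using arg_cong[OF radical_inverse_step[OF p1, of "?K (Suc n)"], of "\<lambda>z. of_nat p ^ n * z"]
    unfolding monna_seq_def \<open>?K n = ?K (Suc n) div p\<close>
    by (simp only: power_Suc2 mult.assoc distrib_left add_diff_cancel_right')
  also have "\<dots> = of_int (int p ^ n * int (?K (Suc n) mod p))" by simp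
  finally show ?thesis
    unfolding rat_padic_abs_of_int_le_iff[OF p] by (metis rat_padic_abs_of_int_le_iff[OF p] dvd_triv_left)
qed

lemma monna_seq_close:
  assumes p: "prime p" and "n \<le> k"
  shows "rat_padic_abs p (monna_seq p x k - monna_seq p x n) \<le> 1 / real p ^ n"
  using assms(2)
proof (induction k rule: dec_induct)
  case (step k)
  have "1 / real p ^ k \<le> 1 / real p ^ n"
    using step.hyps prime_gt_1_nat[OF p] by (intro divide_left_mono power_increasing) auto
  then show ?case
    using rat_padic_abs_ultrametric[OF p, of "monna_seq p x (Suc k) - monna_seq p x k" "monna_seq p x k - monna_seq p x n"]
      monna_seq_step[OF p, of x k] step.IH by simp
qed auto

lemma padic_Cauchy_monna_seq: "padic_Cauchy CARD('p :: prime_card) (monna_seq CARD('p) x)"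
  unfolding padic_Cauchy_def
proof (intro allI impI)
  fix e :: real assume "e > 0"
  then obtain N where N: "1 / real CARD('p) ^ N < e" by (rule inverse_power_CARD_less)
  let ?X = "monna_seq CARD('p) x"
  have "rat_padic_abs CARD('p) (?X m - ?X n) < e" if "m \<ge> N" "n \<ge> N" for m n
    using rat_padic_abs_ultrametric[OF prime_card[where 'a = 'p], of "?X m - ?X N" "?X N - ?X n"]
      monna_seq_close[OF prime_card[where 'a = 'p] that(1), of x]
      monna_seq_close[OF prime_card[where 'a = 'p] that(2), of x] N
      rat_padic_abs_commute[OF prime_card[where 'a = 'p], of "?X N" "?X n"]
    by simp
  then show "\<exists>N. \<forall>m\<ge>N. \<forall>n\<ge>N. rat_padic_abs CARD('p) (?X m - ?X n) < e" by blast
qed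

definition monna :: "real \<Rightarrow> 'p :: prime_card padic" where
  "monna x = abs_padic (Abs_padic_seq (monna_seq CARD('p) x))"

lemma monna_close:
  "(of_nat CARD('p) ^ n * padic_of_rat (radical_inverse CARD('p) (nat \<lfloor>x * real CARD('p) ^ n\<rfloor>)) :: 'p :: prime_card padic)
     \<in> padic_ball (monna x) n"
proof -
  have "padic_of_rat (of_nat CARD('p) ^ n) = (of_nat CARD('p) ^ n :: 'p padic)"
    by (metis padic_of_rat_of_nat of_nat_power)
  moreover have "padic_norm (monna x - padic_of_rat (monna_seq CARD('p) x n) :: 'p padic) \<le> 1 / real CARD('p) ^ n"
    unfolding monna_def
    by (rule padic_norm_limit_diff_le[OF padic_Cauchy_monna_seq monna_seq_close[OF prime_card]])
  ultimately show ?thesis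
    by (simp add: padic_ball_def monna_seq_def padic_of_rat_mult padic_norm_diff_commute)
qed

text \<open>
The first \<open>m\<close> digits of \<open>x\<close>, together with its integral part, determine the ball of radius
\<open>1 / p ^ m\<close> that contains the image of \<open>x\<close>, and each ball belongs to exactly one such beginning \<open>k\<close>.
Fixing the beginning means fixing the integral part of \<open>x * p ^ m\<close>.
\<close>
lemma monna_vimage_ball:
  obtains k where "{x. 0 \<le> x \<and> monna x \<in> padic_ball (a :: 'p :: prime_card padic) m}
    = {real k / real CARD('p) ^ m ..< (real k + 1) / real CARD('p) ^ m}"
proof -
  let ?h = "\<lambda>l. of_nat CARD('p) ^ m * padic_of_rat (radical_inverse CARD('p) l) :: 'p padic"
  obtain k where k: "\<And>l. ?h l \<in> padic_ball a m \<longleftrightarrow> l = k"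
    using radical_inverse_ball[of m a] by blast
  have pos: "real CARD('p) ^ m > 0" by simp
  have ball: "monna x \<in> padic_ball a m \<longleftrightarrow> nat \<lfloor>x * real CARD('p) ^ m\<rfloor> = k" for x
  proof -
    let ?y = "?h (nat \<lfloor>x * real CARD('p) ^ m\<rfloor>)"
    have "padic_ball ?y m = padic_ball (monna x) m"
      by (rule padic_ball_cong[OF monna_close])
    then have "monna x \<in> padic_ball a m \<longleftrightarrow> ?y \<in> padic_ball a m"
      using padic_ball_cong padic_ball_center by blast
    then show ?thesis using k by simp
  qed
  have interval: "(0 \<le> x \<and> nat \<lfloor>x * real CARD('p) ^ m\<rfloor> = k) \<longleftrightarrow>
      x \<in> {real k / real CARD('p) ^ m ..< (real k + 1) / real CARD('p) ^ m}" for x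
  proof -
    have "x \<in> {real k / real CARD('p) ^ m ..< (real k + 1) / real CARD('p) ^ m}
        \<longleftrightarrow> \<lfloor>x * real CARD('p) ^ m\<rfloor> = int k"
      using pos by (simp add: floor_eq_iff pos_divide_le_eq pos_less_divide_eq)
    moreover have "0 \<le> x \<longleftrightarrow> 0 \<le> \<lfloor>x * real CARD('p) ^ m\<rfloor>"
      using mult_le_cancel_right_pos[OF pos, of 0 x] by simp
    ultimately show ?thesis by linarith
  qed
  show thesis
  proof (rule that[of k])
    show "{x. 0 \<le> x \<and> monna x \<in> padic_ball a m}
        = {real k / real CARD('p) ^ m ..< (real k + 1) / real CARD('p) ^ m}"
      by (rule Set.set_eqI) (simp only: mem_Collect_eq ball interval)
  qed
qed


text \<open>
Balls with rational centres and radii \<open>1 / p ^ m\<close> form a countable basis of the topology.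
\<close>
lemma sets_borel_padic:
  "(borel :: 'p :: prime_card padic measure)
     = sigma UNIV (range (\<lambda>(q, m). padic_ball (padic_of_rat q) m))"
proof (rule borel_eq_countable_basis)
  show "countable (range (\<lambda>(q, m). padic_ball (padic_of_rat q :: 'p padic) m))" by simp
  show "topological_basis (range (\<lambda>(q, m). padic_ball (padic_of_rat q :: 'p padic) m))"
  proof (rule topological_basisI)
    fix B assume "B \<in> range (\<lambda>(q, m). padic_ball (padic_of_rat q :: 'p padic) m)"
    then obtain q m where B: "B = padic_ball (padic_of_rat q) m" by auto
    show "open B" unfolding open_dist
    proof
      fix x assume "x \<in> B"
      then have "padic_ball x m = B" unfolding B by (rule padic_ball_cong)
      then show "\<exists>e>0. \<forall>y. dist y x < e \<longrightarrow> y \<in> B"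
        by (intro exI[of _ "1 / real CARD('p) ^ m"]) (auto simp: padic_ball_def dist_padic_def)
    qed
  next
    fix S :: "'p padic set" and x assume S: "open S" "x \<in> S"
    then obtain e where e: "e > 0" "\<And>y. dist y x < e \<Longrightarrow> y \<in> S" unfolding open_dist by blast
    obtain m where m: "1 / real CARD('p) ^ m < e" by (rule inverse_power_CARD_less[OF e(1)])
    have "1 / real CARD('p) ^ m > 0" by simp
    then obtain q where "padic_norm (x - padic_of_rat q) \<le> 1 / real CARD('p) ^ m"
      by (rule padic_of_rat_dense)
    then have x: "x \<in> padic_ball (padic_of_rat q) m" by (simp add: padic_ball_def)
    have "padic_ball (padic_of_rat q) m \<subseteq> S"
      unfolding padic_ball_cong[OF x, symmetric]
      using e(2) m by (force simp: padic_ball_def dist_padic_def)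
    with x show "\<exists>B\<in>range (\<lambda>(q, m). padic_ball (padic_of_rat q) m). x \<in> B \<and> B \<subseteq> S"
      by (intro bexI[of _ "padic_ball (padic_of_rat q) m"]) auto
  qed
qed

lemma monna_measurable [measurable]:
  "(monna :: real \<Rightarrow> 'p :: prime_card padic) \<in> measurable (restrict_space lborel {0..}) borel"
  unfolding sets_borel_padic
proof (rule measurable_measure_of)
  fix B assume "B \<in> range (\<lambda>(q, m). padic_ball (padic_of_rat q :: 'p padic) m)"
  then obtain q m where B: "B = padic_ball (padic_of_rat q) m" by auto
  obtain k where k: "{x. 0 \<le> x \<and> monna x \<in> B} = {real k / real CARD('p) ^ m ..< (real k + 1) / real CARD('p) ^ m}"
    unfolding B by (rule monna_vimage_ball)
  have "monna -` B \<inter> space (restrict_space lborel {0..}) = {x. 0 \<le> x \<and> monna x \<in> B}"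
    by (auto simp: space_restrict_space)
  also have "\<dots> \<in> sets (restrict_space lborel {0..})"
  proof -
    have "{x. 0 \<le> x \<and> monna x \<in> B} \<subseteq> {0..}" by auto
    then show ?thesis by (subst sets_restrict_space_iff) (auto simp: k)
  qed
  finally show "monna -` B \<inter> space (restrict_space lborel {0..}) \<in> sets (restrict_space lborel {0..})" .
qed auto

section \<open>Haar measure on the field and its powers\<close>

definition padic_measure :: "'p :: prime_card padic measure" where
  "padic_measure = distr (restrict_space lborel {0..}) borel monna"

lemma sets_padic_measure [simp, measurable_cong]: "sets padic_measure = sets borel"
  by (simp add: padic_measure_def)

lemma space_padic_measure [simp]: "space padic_measure = UNIV"
  by (simp add: padic_measure_def)

lemma emeasure_padic_ball:
  "emeasure padic_measure (padic_ball (a :: 'p :: prime_card padic) m) = ennreal (1 / real CARD('p) ^ m)"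
proof -
  obtain k where k: "{x. 0 \<le> x \<and> monna x \<in> padic_ball a m} = {real k / real CARD('p) ^ m ..< (real k + 1) / real CARD('p) ^ m}"
    by (rule monna_vimage_ball)
  have "emeasure padic_measure (padic_ball a m)
      = emeasure (restrict_space lborel {0..}) {x. 0 \<le> x \<and> monna x \<in> padic_ball a m}"
    unfolding padic_measure_def
    by (subst emeasure_distr) (auto simp: space_restrict_space intro!: arg_cong2[of _ _ _ _ emeasure])
  also have "\<dots> = emeasure lborel {x. 0 \<le> x \<and> monna x \<in> padic_ball a m}"
    by (rule emeasure_restrict_space) auto
  also have "\<dots> = ennreal ((real k + 1) / real CARD('p) ^ m - real k / real CARD('p) ^ m)"
    unfolding k by (rule emeasure_lborel_Ico) (auto simp: divide_simps)
  also have "(real k + 1) / real CARD('p) ^ m - real k / real CARD('p) ^ m = 1 / real CARD('p) ^ m"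
    by (simp add: diff_divide_distrib[symmetric])
  finally show ?thesis .
qed

lemma padic_unit_balls_cover:
  "countable (range (\<lambda>q. padic_ball (padic_of_rat q :: 'p :: prime_card padic) 0))"
  "(\<Union>q. padic_ball (padic_of_rat q :: 'p padic) 0) = UNIV"
proof -
  have "\<exists>q. x \<in> padic_ball (padic_of_rat q :: 'p padic) 0" for x
    using padic_of_rat_dense[of 1 x] by (auto simp: padic_ball_def)
  then show "(\<Union>q. padic_ball (padic_of_rat q :: 'p padic) 0) = UNIV" by blast
qed simp

lemma sigma_finite_padic_measure: "sigma_finite_measure (padic_measure :: 'p :: prime_card padic measure)"
proof
  show "\<exists>A. countable A \<and> A \<subseteq> sets (padic_measure :: 'p padic measure) \<and> \<Union> A = space padic_measure \<and>
      (\<forall>a\<in>A. emeasure padic_measure a \<noteq> \<infinity>)"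
    using padic_unit_balls_cover[where 'p = 'p]
    by (intro exI[of _ "range (\<lambda>q. padic_ball (padic_of_rat q :: 'p padic) 0)"])
       (auto simp: emeasure_padic_ball)
qed

lemma padic_balls_nested_or_disjoint:
  assumes "m \<le> k"
  shows "padic_ball a m \<inter> padic_ball b k = {} \<or> padic_ball (b :: 'p :: prime_card padic) k \<subseteq> padic_ball a m"
proof -
  have "padic_ball b k \<subseteq> padic_ball a m" if x: "x \<in> padic_ball a m" "x \<in> padic_ball b k" for x
    using padic_ball_cong[OF x(1)] padic_ball_cong[OF x(2)] padic_ball_mono[OF assms, of x] by simp
  then show ?thesis by blast
qed

lemma Int_stable_padic_balls:
  "Int_stable (insert {} (range (\<lambda>(a, m). padic_ball (a :: 'p :: prime_card padic) m)))"
proof (rule Int_stableI)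
  fix A B assume AB: "A \<in> insert {} (range (\<lambda>(a, m). padic_ball (a :: 'p padic) m))"
    "B \<in> insert {} (range (\<lambda>(a, m). padic_ball (a :: 'p padic) m))"
  have "A \<inter> B \<in> {{}, A, B}"
  proof (cases "A = {} \<or> B = {}")
    case False
    then obtain a m b k where e: "A = padic_ball a m" "B = padic_ball b k" using AB by auto
    show ?thesis using padic_balls_nested_or_disjoint[of m k a b] padic_balls_nested_or_disjoint[of k m b a]
      unfolding e by (cases "m \<le> k") auto
  qed auto
  with AB show "A \<inter> B \<in> insert {} (range (\<lambda>(a, m). padic_ball (a :: 'p padic) m))" by auto
qed

lemma sets_borel_padic_balls:
  "sets (borel :: 'p :: prime_card padic measure)
     = sigma_sets UNIV (insert {} (range (\<lambda>(a, m). padic_ball a m)))"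
proof
  have "sets (borel :: 'p padic measure) = sigma_sets UNIV (range (\<lambda>(q, m). padic_ball (padic_of_rat q) m))"
    by (subst sets_borel_padic) simp
  also have "\<dots> \<subseteq> sigma_sets UNIV (insert {} (range (\<lambda>(a, m). padic_ball a m)))"
    by (rule sigma_sets_mono') auto
  finally show "sets (borel :: 'p padic measure) \<subseteq> \<dots>" .
  show "sigma_sets UNIV (insert {} (range (\<lambda>(a, m). padic_ball (a :: 'p padic) m))) \<subseteq> sets borel"
  proof -
    have "insert {} (range (\<lambda>(a, m). padic_ball (a :: 'p padic) m)) \<subseteq> sets borel" by auto
    from sets.sigma_sets_subset[OF this] show ?thesis by (simp only: space_borel)
  qed
qed

lemma continuous_on_padic_add: "continuous_on UNIV (\<lambda>x. v + x :: 'p :: prime_card padic)"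
  unfolding continuous_on_iff by (auto simp: dist_padic_def)

lemma measurable_padic_add [measurable]: "(\<lambda>x. v + x :: 'p :: prime_card padic) \<in> measurable borel borel"
  by (rule borel_measurable_continuous_onI[OF continuous_on_padic_add])

lemma padic_ball_vimage_add: "(\<lambda>x. v + x) -` padic_ball a m = padic_ball (a - v :: 'p :: prime_card padic) m"
  by (auto simp: padic_ball_def algebra_simps)

text \<open>
A translate of a ball is a ball of the same radius, so the measure and its translate agree on all
balls.  These generate the Borel sets and are stable under intersection, because any two balls
are nested or disjoint.
\<close>
lemma distr_padic_measure_add:
  "distr padic_measure borel (\<lambda>x. v + x) = (padic_measure :: 'p :: prime_card padic measure)"
proof -
  have ball: "emeasure (distr padic_measure borel (\<lambda>x. v + x)) (padic_ball a m)
      = emeasure padic_measure (padic_ball (a :: 'p padic) m)" for a m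
    by (subst emeasure_distr) (auto simp: padic_ball_vimage_add emeasure_padic_ball)
  show ?thesis
  proof (rule measure_eqI_generator_eq_countable[OF Int_stable_padic_balls _ _ _ _ _ _ padic_unit_balls_cover(1)])
    fix X :: "'p padic set" assume "X \<in> insert {} (range (\<lambda>(a, m). padic_ball a m))"
    then show "emeasure (distr padic_measure borel (\<lambda>x. v + x)) X = emeasure padic_measure X"
      using ball by auto
  next
    fix X :: "'p padic set" assume "X \<in> range (\<lambda>q. padic_ball (padic_of_rat q) 0)"
    then show "emeasure (distr padic_measure borel (\<lambda>x. v + x)) X \<noteq> \<infinity>"
      by (auto simp: ball emeasure_padic_ball)
  qed (auto simp: sets_borel_padic_balls padic_unit_balls_cover(2))
qed

text \<open>
Boxes determine a product measure, and translation of a box is translation of each of its sides.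
\<close>
lemma haar_measure_exists:
  fixes I :: "'i set"
  assumes "finite I"
  shows "is_haar_measure I (\<Pi>\<^sub>M i\<in>I. (padic_measure :: 'p :: prime_card padic measure))"
proof -
  let ?M = "\<Pi>\<^sub>M i\<in>I. (padic_measure :: 'p padic measure)"
  interpret product_sigma_finite "\<lambda>_. padic_measure :: 'p padic measure"
    by (rule product_sigma_finite.intro) (rule sigma_finite_padic_measure)
  have sp: "space ?M = I \<rightarrow>\<^sub>E UNIV" by (simp add: space_PiM)
  have meas: "(\<lambda>x. \<lambda>i\<in>I. v i + x i) \<in> measurable ?M ?M" for v :: "'i \<Rightarrow> 'p padic"
    by measurable
  have inv: "distr ?M ?M (\<lambda>x. \<lambda>i\<in>I. v i + x i) = ?M" for v
  proof (rule PiM_eqI[OF assms])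
    fix A :: "_ \<Rightarrow> 'p padic set" assume A: "\<And>i. i \<in> I \<Longrightarrow> A i \<in> sets padic_measure"
    have "emeasure (distr ?M ?M (\<lambda>x. \<lambda>i\<in>I. v i + x i)) (Pi\<^sub>E I A)
        = emeasure ?M ((\<lambda>x. \<lambda>i\<in>I. v i + x i) -` Pi\<^sub>E I A \<inter> space ?M)"
      using A assms by (intro emeasure_distr meas sets_PiM_I_finite) auto
    also have "(\<lambda>x. \<lambda>i\<in>I. v i + x i) -` Pi\<^sub>E I A \<inter> space ?M = Pi\<^sub>E I (\<lambda>i. (\<lambda>x. v i + x) -` A i)"
      by (auto simp: sp PiE_iff)
    also have "emeasure ?M \<dots> = (\<Prod>i\<in>I. emeasure padic_measure ((\<lambda>x. v i + x) -` A i))"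
      using A assms measurable_sets[OF measurable_padic_add] by (intro emeasure_PiM) auto
    also have "\<dots> = (\<Prod>i\<in>I. emeasure padic_measure (A i))"
    proof (rule prod.cong[OF refl])
      fix i assume "i \<in> I"
      have "emeasure padic_measure (A i) = emeasure (distr padic_measure borel (\<lambda>x. v i + x)) (A i)"
        by (simp add: distr_padic_measure_add)
      also have "\<dots> = emeasure padic_measure ((\<lambda>x. v i + x) -` A i)"
        using A[OF \<open>i \<in> I\<close>] by (subst emeasure_distr) auto
      finally show "emeasure padic_measure ((\<lambda>x. v i + x) -` A i) = emeasure padic_measure (A i)" ..
    qed
    finally show "emeasure (distr ?M ?M (\<lambda>x. \<lambda>i\<in>I. v i + x i)) (Pi\<^sub>E I A)
      = (\<Prod>i\<in>I. emeasure padic_measure (A i))" .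
  qed simp
  \<comment> \<open>The image of a set under translation by \<open>v\<close> is its preimage under translation by \<open>- v\<close>.\<close>
  have "emeasure ?M ((\<lambda>x. \<lambda>i\<in>I. v i + x i) ` A) = emeasure ?M A"
    if v: "v \<in> I \<rightarrow>\<^sub>E UNIV" and A: "A \<in> sets ?M" for v A
  proof -
    have "A \<subseteq> I \<rightarrow>\<^sub>E UNIV" using sets.sets_into_space[OF A] sp by simp
    then have "(\<lambda>x. \<lambda>i\<in>I. v i + x i) ` A = (\<lambda>x. \<lambda>i\<in>I. - v i + x i) -` A \<inter> space ?M"
    proof (intro Set.set_eqI iffI)
      fix y assume sub: "A \<subseteq> I \<rightarrow>\<^sub>E UNIV" and "y \<in> (\<lambda>x. \<lambda>i\<in>I. v i + x i) ` A"
      then obtain x where x: "x \<in> A" "y = (\<lambda>i\<in>I. v i + x i)" by auto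
      have "(\<lambda>i\<in>I. - v i + y i) = x"
        using x sub by (auto simp: fun_eq_iff PiE_iff extensional_def)
      then show "y \<in> (\<lambda>x. \<lambda>i\<in>I. - v i + x i) -` A \<inter> space ?M" using x sp by auto
    next
      fix y assume sub: "A \<subseteq> I \<rightarrow>\<^sub>E UNIV" and y: "y \<in> (\<lambda>x. \<lambda>i\<in>I. - v i + x i) -` A \<inter> space ?M"
      then have "(\<lambda>i\<in>I. v i + (\<lambda>i\<in>I. - v i + y i) i) = y"
        using sp by (auto simp: fun_eq_iff PiE_iff extensional_def)
      with y show "y \<in> (\<lambda>x. \<lambda>i\<in>I. v i + x i) ` A"
        by (intro image_eqI[of _ _ "\<lambda>i\<in>I. - v i + y i"]) auto
    qed
    then have "emeasure ?M ((\<lambda>x. \<lambda>i\<in>I. v i + x i) ` A) = emeasure (distr ?M ?M (\<lambda>x. \<lambda>i\<in>I. - v i + x i)) A"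
      by (simp only: emeasure_distr[OF meas[of "\<lambda>i. - v i"] A])
    then show ?thesis using inv[of "\<lambda>i. - v i"] by simp
  qed
  moreover have "emeasure ?M (I \<rightarrow>\<^sub>E {x. padic_norm x \<le> 1}) = 1"
  proof -
    have "{x :: 'p padic. padic_norm x \<le> 1} = padic_ball 0 0" by (simp add: padic_ball_def)
    then have "emeasure ?M (I \<rightarrow>\<^sub>E {x. padic_norm x \<le> 1}) = (\<Prod>i\<in>I. emeasure padic_measure (padic_ball (0 :: 'p padic) 0))"
      using assms by (simp only:) (rule emeasure_PiM, auto)
    then show ?thesis by (simp add: emeasure_padic_ball)
  qed
  moreover have "sets ?M = sets (\<Pi>\<^sub>M i\<in>I. (borel :: 'p padic measure))"
    by (rule sets_PiM_cong) auto
  ultimately show ?thesis unfolding is_haar_measure_def by blast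
qed

lemma is_haar_measure_haar_measure:
  "finite I \<Longrightarrow> is_haar_measure I (haar_measure I :: ('i \<Rightarrow> 'p :: prime_card padic) measure)"
  unfolding haar_measure_def by (rule someI) (rule haar_measure_exists)

section \<open>The volume of a polydisc\<close>

definition polyball :: "'i set \<Rightarrow> ('i \<Rightarrow> 'p :: prime_card padic) \<Rightarrow> nat \<Rightarrow> ('i \<Rightarrow> 'p padic) set" where
  "polyball I b m = (\<Pi>\<^sub>E i\<in>I. padic_ball (b i) m)"

lemma polyball_meet_imp_close:
  assumes "polyball I a m \<inter> polyball I b m \<noteq> {}" "i \<in> I"
  shows "padic_norm (a i - b i :: 'p :: prime_card padic) \<le> 1 / real CARD('p) ^ m"
proof -
  obtain x where "x \<in> polyball I a m" "x \<in> polyball I b m" using assms by blast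
  then have "padic_norm (x i - a i) \<le> 1 / real CARD('p) ^ m" "padic_norm (x i - b i) \<le> 1 / real CARD('p) ^ m"
    using assms(2) by (auto simp: polyball_def padic_ball_def PiE_iff)
  then show ?thesis
    by (intro padic_norm_diff_trans[of "a i" "x i" _ "b i"]) (simp_all add: padic_norm_diff_commute[of "a i"])
qed

context
  fixes I :: "'i set" and M :: "('i \<Rightarrow> 'p :: prime_card padic) measure"
  assumes I: "finite I" and haar: "is_haar_measure I M"
begin

lemma polyball_sets: "polyball I b m \<in> sets M"
  using haar I unfolding is_haar_measure_def polyball_def
  by (auto intro!: sets_PiM_I_finite)

lemma emeasure_polyball_translate: "emeasure M (polyball I b m) = emeasure M (polyball I (\<lambda>_. 0) m)"
proof -
  have "(\<lambda>x. \<lambda>i\<in>I. restrict b I i + x i) ` polyball I (\<lambda>_. 0) m = polyball I b m"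
  proof (intro Set.set_eqI iffI)
    fix y assume y: "y \<in> polyball I b m"
    then have "y = (\<lambda>i\<in>I. restrict b I i + (\<lambda>i\<in>I. y i - b i) i)"
      by (auto simp: polyball_def PiE_iff extensional_def fun_eq_iff)
    moreover have "(\<lambda>i\<in>I. y i - b i) \<in> polyball I (\<lambda>_. 0) m"
      using y by (auto simp: polyball_def padic_ball_def PiE_iff)
    ultimately show "y \<in> (\<lambda>x. \<lambda>i\<in>I. restrict b I i + x i) ` polyball I (\<lambda>_. 0) m"
      by (rule image_eqI)
  qed (auto simp: polyball_def padic_ball_def PiE_iff)
  moreover have "emeasure M ((\<lambda>x. \<lambda>i\<in>I. v i + x i) ` A) = emeasure M A"
    if "v \<in> I \<rightarrow>\<^sub>E UNIV" "A \<in> sets M" for v A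
    using haar that unfolding is_haar_measure_def by blast
  from this[of "restrict b I", OF _ polyball_sets[of "\<lambda>_. 0" m]]
  have "emeasure M ((\<lambda>x. \<lambda>i\<in>I. restrict b I i + x i) ` polyball I (\<lambda>_. 0) m)
      = emeasure M (polyball I (\<lambda>_. 0) m)" by auto
  ultimately show ?thesis by simp
qed

text \<open>
Choosing a residue modulo \<open>p ^ m\<close> in each coordinate splits the unit polydisc, of measure \<open>1\<close>, into
\<open>p ^ (m * card I)\<close> disjoint translates of a polydisc of radius \<open>1 / p ^ m\<close>.
\<close>
lemma emeasure_polyball: "emeasure M (polyball I b m) = ennreal (1 / real CARD('p) ^ (m * card I))"
proof -
  let ?R = "I \<rightarrow>\<^sub>E {..<CARD('p) ^ m}"
  let ?F = "\<lambda>c. polyball I (\<lambda>i. of_nat (c i)) m :: ('i \<Rightarrow> 'p padic) set"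
  let ?e = "emeasure M (polyball I (\<lambda>_. 0) m)"
  have R: "finite ?R" using I by (intro finite_PiE) auto
  have dis: "disjoint_family_on ?F ?R"
    unfolding disjoint_family_on_def
  proof (intro ballI impI)
    fix c c' assume c: "c \<in> ?R" "c' \<in> ?R" "c \<noteq> c'"
    show "?F c \<inter> ?F c' = {}"
    proof (rule ccontr)
      assume ne: "?F c \<inter> ?F c' \<noteq> {}"
      have "c i = c' i" if "i \<in> I" for i
        using padic_residue_unique[OF _ _ polyball_meet_imp_close[OF ne that]] c that by (auto simp: PiE_iff)
      then have "c = c'" using c by (intro PiE_ext) auto
      with c show False by simp
    qed
  qed
  \<comment> \<open>The unit polydisc is the set of known measure by which Haar measure is normalised.\<close>
  have "(\<Union>c\<in>?R. ?F c) = (I \<rightarrow>\<^sub>E {x. padic_norm x \<le> 1})"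
  proof (intro Set.set_eqI iffI)
    fix x assume "x \<in> (\<Union>c\<in>?R. ?F c)"
    then obtain c where c: "c \<in> ?R" "x \<in> ?F c" by blast
    have "padic_norm (x i) \<le> 1" if "i \<in> I" for i
    proof -
      have "x i \<in> padic_ball (of_nat (c i)) 0"
        using c that padic_ball_mono[of 0 m] by (auto simp: polyball_def PiE_iff)
      then show ?thesis
        using padic_norm_add_le[of "x i - of_nat (c i)" 1 "of_nat (c i)"]
          padic_norm_of_nat_le_1[of "c i", where 'p = 'p]
        by (simp add: padic_ball_def)
    qed
    then show "x \<in> (I \<rightarrow>\<^sub>E {x. padic_norm x \<le> 1})" using c by (auto simp: polyball_def PiE_iff)
  next
    fix x :: "'i \<Rightarrow> 'p padic" assume x: "x \<in> (I \<rightarrow>\<^sub>E {x. padic_norm x \<le> 1})"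
    have "\<forall>i\<in>I. \<exists>c. c < CARD('p) ^ m \<and> padic_norm (x i - of_nat c) \<le> 1 / real CARD('p) ^ m"
      using x padic_residue[of _ m] by (metis PiE_mem mem_Collect_eq)
    then obtain c where "\<And>i. i \<in> I \<Longrightarrow> c i < CARD('p) ^ m \<and> padic_norm (x i - of_nat (c i)) \<le> 1 / real CARD('p) ^ m"
      by metis
    then have "restrict c I \<in> ?R" "x \<in> ?F (restrict c I)"
      using x by (auto simp: polyball_def padic_ball_def PiE_iff)
    then show "x \<in> (\<Union>c\<in>?R. ?F c)" by blast
  qed
  then have "emeasure M (\<Union>c\<in>?R. ?F c) = 1" using haar by (simp add: is_haar_measure_def)
  moreover have "(\<Sum>c\<in>?R. emeasure M (?F c)) = emeasure M (\<Union>c\<in>?R. ?F c)"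
    using R dis polyball_sets by (intro sum_emeasure) auto
  ultimately have "(\<Sum>c\<in>?R. emeasure M (?F c)) = 1" by simp
  moreover have "(\<Sum>c\<in>?R. emeasure M (?F c)) = (\<Sum>c\<in>?R. ?e)"
    by (intro sum.cong refl emeasure_polyball_translate)
  ultimately have "(\<Sum>c\<in>?R. ?e) = 1" by simp
  moreover have "card ?R = CARD('p) ^ (m * card I)" by (simp add: card_PiE I power_mult)
  moreover have "ennreal (real CARD('p) ^ (m * card I)) = of_nat (CARD('p) ^ (m * card I))"
    by (metis ennreal_of_nat_eq_real_of_nat of_nat_power)
  ultimately have e: "ennreal (real CARD('p) ^ (m * card I)) * ?e = 1" by simp
  have "?e \<noteq> \<infinity>" using e by (auto simp: ennreal_mult_top)
  then obtain s where s: "s \<ge> 0" "?e = ennreal s" by (cases "?e") auto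
  have "ennreal (real CARD('p) ^ (m * card I) * s) = 1"
    using e s by (simp add: ennreal_mult)
  then have "real CARD('p) ^ (m * card I) * s = 1" by (metis ennreal_eq_1)
  then have "s = 1 / real CARD('p) ^ (m * card I)" by (simp add: field_simps)
  with s show ?thesis using emeasure_polyball_translate[of b m] by simp
qed

end

section \<open>Projective distance as closeness up to a unit\<close>

definition unit_close :: "'i set \<Rightarrow> real \<Rightarrow> ('i \<Rightarrow> 'p :: prime_card padic) \<Rightarrow> ('i \<Rightarrow> 'p padic) \<Rightarrow> bool" where
  "unit_close I r a b \<longleftrightarrow> (\<exists>t. padic_norm t = 1 \<and> (\<forall>i\<in>I. padic_norm (b i - t * a i) \<le> r))"

lemma unit_close_sym:
  assumes "unit_close I r a b" shows "unit_close I r b a"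
proof -
  obtain t where t: "padic_norm t = 1" "\<And>i. i \<in> I \<Longrightarrow> padic_norm (b i - t * a i) \<le> r"
    using assms unfolding unit_close_def by blast
  have t0: "t \<noteq> 0" using t(1) by auto
  have "padic_norm (a i - inverse t * b i) \<le> r" if "i \<in> I" for i
  proof -
    have "a i - inverse t * b i = inverse t * (t * a i - b i)" using t0 by (simp add: right_diff_distrib)
    then show ?thesis using t(1) t(2)[OF that]
      by (simp add: padic_norm_mult padic_norm_inverse padic_norm_diff_commute[of "t * a i"])
  qed
  moreover have "padic_norm (inverse t) = 1" using t by (simp add: padic_norm_inverse)
  ultimately show ?thesis unfolding unit_close_def by blast
qed

lemma unit_close_trans:
  assumes "unit_close I r a b" "unit_close I r b c" shows "unit_close I r a c"
proof -
  obtain t where t: "padic_norm t = 1" "\<And>i. i \<in> I \<Longrightarrow> padic_norm (b i - t * a i) \<le> r"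
    using assms(1) unfolding unit_close_def by blast
  obtain s where s: "padic_norm s = 1" "\<And>i. i \<in> I \<Longrightarrow> padic_norm (c i - s * b i) \<le> r"
    using assms(2) unfolding unit_close_def by blast
  have "padic_norm (c i - (s * t) * a i) \<le> r" if "i \<in> I" for i
  proof (rule padic_norm_diff_trans[OF s(2)[OF that]])
    have "s * b i - s * t * a i = s * (b i - t * a i)" by (simp add: algebra_simps)
    then show "padic_norm (s * b i - s * t * a i) \<le> r" using s(1) t(2)[OF that] by (simp add: padic_norm_mult)
  qed
  moreover have "padic_norm (s * t) = 1" using t s by (simp add: padic_norm_mult)
  ultimately show ?thesis unfolding unit_close_def by blast
qed

lemma unit_close_of_close:
  assumes "\<And>i. i \<in> I \<Longrightarrow> padic_norm (b i - a i) \<le> r" shows "unit_close I r a b"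
  unfolding unit_close_def using assms by (intro exI[of _ 1]) auto

lemma unit_close_refl: "r \<ge> 0 \<Longrightarrow> unit_close I r a a"
  by (rule unit_close_of_close) simp

lemma unit_sphere_iff:
  assumes "finite I" "I \<noteq> {}"
  shows "a \<in> unit_sphere I \<longleftrightarrow> a \<in> I \<rightarrow>\<^sub>E UNIV \<and> (\<forall>i\<in>I. padic_norm (a i) \<le> 1) \<and> (\<exists>i\<in>I. padic_norm (a i) = 1)"
proof -
  let ?f = "\<lambda>i. padic_norm (a i)"
  have "max_norm I a = 1 \<longleftrightarrow> 1 \<in> ?f ` I \<and> (\<forall>x\<in>?f ` I. x \<le> 1)"
    unfolding max_norm_def using assms by (intro Max_eq_iff) auto
  moreover have "1 \<in> ?f ` I \<longleftrightarrow> (\<exists>i\<in>I. ?f i = 1)" by (metis image_iff)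
  ultimately have "max_norm I a = 1 \<longleftrightarrow> (\<forall>i\<in>I. ?f i \<le> 1) \<and> (\<exists>i\<in>I. ?f i = 1)" by blast
  then show ?thesis by (auto simp: unit_sphere_def)
qed

lemma wedge_norm_le_iff:
  assumes "finite I" "I \<noteq> {}"
  shows "wedge_norm I a b \<le> r \<longleftrightarrow> (\<forall>i\<in>I. \<forall>j\<in>I. padic_norm (a i * b j - a j * b i) \<le> r)"
  unfolding wedge_norm_def using assms by (subst Max_le_iff) auto

text \<open>
If all minors are small, choose a coordinate \<open>k\<close> in which \<open>a\<close> is a unit; the minors involving \<open>k\<close>
say that \<open>b\<close> is close to \<open>b k / a k\<close> times \<open>a\<close>.  This factor must be a unit, since otherwise
all coordinates of \<open>b\<close> would have absolute value below \<open>1\<close>; here \<open>r < 1\<close> is essential.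
Conversely, minors of \<open>a\<close> and \<open>b\<close> equal those of \<open>a\<close> and \<open>b - t * a\<close>.
\<close>
lemma wedge_norm_le_iff_unit_close:
  assumes I: "finite I" "I \<noteq> {}" and r: "r < 1"
    and a: "a \<in> unit_sphere I" and b: "b \<in> unit_sphere I"
  shows "wedge_norm I a b \<le> r \<longleftrightarrow> unit_close I r a b"
proof
  have a1: "\<And>i. i \<in> I \<Longrightarrow> padic_norm (a i) \<le> 1" and b1: "\<And>i. i \<in> I \<Longrightarrow> padic_norm (b i) \<le> 1"
    using a b unfolding unit_sphere_iff[OF I] by auto
  obtain k where k: "k \<in> I" "padic_norm (a k) = 1" using a unfolding unit_sphere_iff[OF I] by auto
  obtain l where l: "l \<in> I" "padic_norm (b l) = 1" using b unfolding unit_sphere_iff[OF I] by auto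
  have ak: "a k \<noteq> 0" using k by auto
  assume "wedge_norm I a b \<le> r"
  then have w: "\<And>j. j \<in> I \<Longrightarrow> padic_norm (a k * b j - a j * b k) \<le> r"
    unfolding wedge_norm_le_iff[OF I] using k by blast
  \<comment> \<open>The factor is forced by the requirement that coordinate \<open>k\<close> agree exactly.\<close>
  define t where "t = b k / a k"
  have close: "padic_norm (b j - t * a j) \<le> r" if "j \<in> I" for j
  proof -
    have "a k * b j - a j * b k = a k * (b j - t * a j)" using ak by (simp add: t_def field_simps)
    then show ?thesis using w[OF that] k by (simp add: padic_norm_mult)
  qed
  have "padic_norm (t * a l) = 1"
    using padic_norm_eq_of_close[of "b l" "t * a l"] close[OF l(1)] r l by simp
  moreover have "padic_norm t \<le> 1" using b1[OF k(1)] k by (simp add: t_def padic_norm_divide)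
  ultimately have "padic_norm t = 1"
    using a1[OF l(1)] mult_right_le_one_le[of "padic_norm t" "padic_norm (a l)"] by (simp add: padic_norm_mult)
  with close show "unit_close I r a b" unfolding unit_close_def by blast
next
  assume "unit_close I r a b"
  then obtain t where t: "padic_norm t = 1" "\<And>i. i \<in> I \<Longrightarrow> padic_norm (b i - t * a i) \<le> r"
    unfolding unit_close_def by blast
  have a1: "padic_norm (a i * x) \<le> padic_norm x" if "i \<in> I" for i x
    using a that unfolding unit_sphere_iff[OF I] by (simp add: padic_norm_mult mult_left_le_one_le)
  show "wedge_norm I a b \<le> r" unfolding wedge_norm_le_iff[OF I]
  proof (intro ballI)
    fix i j assume ij: "i \<in> I" "j \<in> I"
    have "a i * b j - a j * b i = a i * (b j - t * a j) - a j * (b i - t * a i)" by (simp add: algebra_simps)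
    then show "padic_norm (a i * b j - a j * b i) \<le> r"
      using a1[OF ij(1)] a1[OF ij(2)] t(2)[OF ij(1)] t(2)[OF ij(2)]
      by (simp only:) (intro padic_norm_diff_le; blast intro: order_trans)
  qed
qed

lemma proj_point_scale:
  assumes "k \<noteq> 0"
  shows "proj_point I (\<lambda>i\<in>I. k * a i) = proj_point I a"
proof (intro Set.set_eqI iffI)
  fix x assume "x \<in> proj_point I (\<lambda>i\<in>I. k * a i)"
  then obtain c where "c \<noteq> 0" "x = (\<lambda>i\<in>I. c * (\<lambda>i\<in>I. k * a i) i)" unfolding proj_point_def by auto
  then have "c * k \<noteq> 0" "x = (\<lambda>i\<in>I. (c * k) * a i)" using assms by (auto simp: fun_eq_iff)
  then show "x \<in> proj_point I a" unfolding proj_point_def by blast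
next
  fix x assume "x \<in> proj_point I a"
  then obtain c where "c \<noteq> 0" "x = (\<lambda>i\<in>I. c * a i)" unfolding proj_point_def by auto
  then have "c / k \<noteq> 0" "x = (\<lambda>i\<in>I. (c / k) * (\<lambda>i\<in>I. k * a i) i)" using assms by (auto simp: fun_eq_iff)
  then show "x \<in> proj_point I (\<lambda>i\<in>I. k * a i)" unfolding proj_point_def by blast
qed

lemma proj_point_self: "a \<in> I \<rightarrow>\<^sub>E UNIV \<Longrightarrow> a \<in> proj_point I a"
  unfolding proj_point_def by (intro CollectI exI[of _ 1]) (auto simp: fun_eq_iff PiE_iff extensional_def)

lemma proj_space_eq_image_sphere:
  assumes I: "finite I" "I \<noteq> {}"
  shows "proj_space I = proj_point I ` unit_sphere I"
proof (intro Set.set_eqI iffI)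
  fix x assume "x \<in> proj_space I"
  then obtain a where a: "a \<in> I \<rightarrow>\<^sub>E UNIV" "\<exists>i\<in>I. a i \<noteq> 0" "x = proj_point I a"
    unfolding proj_space_def by auto
  \<comment> \<open>Dividing by a coordinate of maximal absolute value normalises the vector.\<close>
  have "max_norm I a \<in> (\<lambda>i. padic_norm (a i)) ` I" unfolding max_norm_def using I by (intro Max_in) auto
  then obtain k where k: "k \<in> I" "max_norm I a = padic_norm (a k)" by auto
  have le: "padic_norm (a i) \<le> padic_norm (a k)" if "i \<in> I" for i
    unfolding k(2)[symmetric] max_norm_def using I that by (intro Max_ge) auto
  obtain i where "i \<in> I" "a i \<noteq> 0" using a by auto
  then have "padic_norm (a i) > 0" by (metis padic_norm_eq_0 padic_norm_nonneg order_le_less)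
  then have pos: "padic_norm (a k) > 0" using le[OF \<open>i \<in> I\<close>] by linarith
  then have ak: "inverse (a k) \<noteq> 0" by auto
  have "(\<lambda>i\<in>I. inverse (a k) * a i) \<in> unit_sphere I"
    unfolding unit_sphere_iff[OF I] using pos le k
    by (auto simp: padic_norm_mult padic_norm_inverse padic_norm_divide field_simps intro!: bexI[of _ k])
  moreover have "x = proj_point I (\<lambda>i\<in>I. inverse (a k) * a i)"
    unfolding a(3) by (rule proj_point_scale[OF ak, symmetric])
  ultimately show "x \<in> proj_point I ` unit_sphere I" by blast
next
  fix x assume "x \<in> proj_point I ` unit_sphere I"
  then obtain a where a: "a \<in> unit_sphere I" "x = proj_point I a" by auto
  then have "a \<in> I \<rightarrow>\<^sub>E UNIV" "\<exists>i\<in>I. a i \<noteq> 0" unfolding unit_sphere_iff[OF I] by force+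
  then show "x \<in> proj_space I" using a unfolding proj_space_def by blast
qed

text \<open>
Two representatives of a point on the unit sphere are proportional, and the factor is a unit because
both have norm \<open>1\<close>.
\<close>
lemma sphere_rep_unit_close:
  assumes I: "finite I" "I \<noteq> {}" and a: "a \<in> unit_sphere I" and r: "r \<ge> 0"
  shows "sphere_rep I (proj_point I a) \<in> unit_sphere I"
    "unit_close I r a (sphere_rep I (proj_point I a))"
proof -
  let ?b = "sphere_rep I (proj_point I a)"
  have b: "?b \<in> unit_sphere I" "proj_point I ?b = proj_point I a"
    using someI[of "\<lambda>b. b \<in> unit_sphere I \<and> proj_point I b = proj_point I a" a] a
    unfolding sphere_rep_def by auto
  show "?b \<in> unit_sphere I" by (rule b)
  have "?b \<in> proj_point I a"
    using proj_point_self[of ?b I] b unfolding unit_sphere_iff[OF I] by simp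
  then obtain c where c: "c \<noteq> 0" "?b = (\<lambda>i\<in>I. c * a i)" unfolding proj_point_def by auto
  have bc: "?b i = c * a i" if "i \<in> I" for i using fun_cong[OF c(2), of i] that by simp
  obtain i where i: "i \<in> I" "padic_norm (a i) = 1" using a unfolding unit_sphere_iff[OF I] by auto
  obtain j where j: "j \<in> I" "padic_norm (?b j) = 1" using b(1) unfolding unit_sphere_iff[OF I] by auto
  have "padic_norm (?b i) \<le> 1" "padic_norm (a j) \<le> 1" using a b(1) i j unfolding unit_sphere_iff[OF I] by auto
  then have "padic_norm c = 1"
    using bc[OF i(1)] bc[OF j(1)] i j mult_right_le_one_le[of "padic_norm c" "padic_norm (a j)"]
    by (simp add: padic_norm_mult)
  then show "unit_close I r a ?b" unfolding unit_close_def using bc r by (intro exI[of _ c]) auto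
qed

text \<open>
Closeness up to a unit does not see the choice of representatives, so that the distance may be
computed with any of them.
\<close>
lemma proj_point_in_proj_ball_iff:
  assumes I: "finite I" "I \<noteq> {}" and r: "0 \<le> r" "r < 1"
    and a: "a \<in> unit_sphere I" and b: "b \<in> unit_sphere I"
  shows "proj_point I b \<in> proj_ball I (proj_point I a) r \<longleftrightarrow> unit_close I r a b"
proof -
  have "proj_point I b \<in> proj_space I" using b proj_space_eq_image_sphere[OF I] by auto
  then have "proj_point I b \<in> proj_ball I (proj_point I a) r \<longleftrightarrow>
      unit_close I r (sphere_rep I (proj_point I a)) (sphere_rep I (proj_point I b))"
    unfolding proj_ball_def proj_dist_def
    using wedge_norm_le_iff_unit_close[OF I r(2)] sphere_rep_unit_close(1)[OF I _ r(1)] a b by auto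
  also have "\<dots> \<longleftrightarrow> unit_close I r a b"
    using sphere_rep_unit_close(2)[OF I a r(1)] sphere_rep_unit_close(2)[OF I b r(1)]
    by (meson unit_close_sym unit_close_trans)
  finally show ?thesis .
qed

section \<open>Balls and tubes in projective space\<close>

text \<open>
For \<open>a\<close> on the unit sphere and \<open>m \<ge> 1\<close>, the vectors of norm \<open>1\<close> above the projective ball of radius
\<open>1 / p ^ m\<close> around the point with coordinates \<open>a\<close>.
\<close>
definition ball_cone :: "'i set \<Rightarrow> ('i \<Rightarrow> 'p :: prime_card padic) \<Rightarrow> nat \<Rightarrow> ('i \<Rightarrow> 'p padic) set" where
  "ball_cone I a m = {b \<in> unit_sphere I. unit_close I (1 / real CARD('p) ^ m) a b}"

lemma inverse_power_CARD_less_1: "m \<ge> 1 \<Longrightarrow> 1 / real CARD('p :: prime_card) ^ m < 1"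
  using one_less_power[of "real CARD('p)" m] CARD_gt_1[where 'p = 'p] by simp

lemma ball_cone_cong:
  "unit_close I (1 / real CARD('p) ^ m) a b \<Longrightarrow> ball_cone I a m = ball_cone I (b :: 'i \<Rightarrow> 'p :: prime_card padic) m"
  unfolding ball_cone_def by (meson unit_close_sym unit_close_trans)

lemma ball_cone_eq_iff:
  assumes "a \<in> unit_sphere I"
  shows "ball_cone I a m = ball_cone I b m \<longleftrightarrow> unit_close I (1 / real CARD('p) ^ m) a (b :: 'i \<Rightarrow> 'p :: prime_card padic)"
proof
  assume "ball_cone I a m = ball_cone I b m"
  moreover have "a \<in> ball_cone I a m" using assms by (simp add: ball_cone_def unit_close_refl)
  ultimately show "unit_close I (1 / real CARD('p) ^ m) a b" by (auto simp: ball_cone_def intro: unit_close_sym)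
qed (rule ball_cone_cong)

text \<open>
A unit factor matters only modulo \<open>p ^ m\<close>, so it can be replaced by a natural number \<open>c < p ^ m\<close>
prime to \<open>p\<close>.
\<close>
lemma ball_cone_eq_UN_polyball:
  fixes a :: "'i \<Rightarrow> 'p :: prime_card padic"
  assumes I: "finite I" "I \<noteq> {}" and m: "m \<ge> 1" and a: "a \<in> unit_sphere I"
  shows "ball_cone I a m
    = (\<Union>c\<in>{c. c < CARD('p) ^ m \<and> \<not> CARD('p) dvd c}. polyball I (\<lambda>i. of_nat c * a i) m)"
proof (intro Set.set_eqI iffI)
  let ?r = "1 / real CARD('p) ^ m"
  have r1: "?r < 1" by (rule inverse_power_CARD_less_1[OF m])
  fix b assume "b \<in> ball_cone I a m"
  then obtain t where b: "b \<in> unit_sphere I" and t: "padic_norm t = 1" "\<And>i. i \<in> I \<Longrightarrow> padic_norm (b i - t * a i) \<le> ?r"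
    unfolding ball_cone_def unit_close_def by blast
  obtain c where c: "c < CARD('p) ^ m" "padic_norm (t - of_nat c) \<le> ?r"
    using padic_residue[of t m] t by auto
  have "padic_norm (of_nat c :: 'p padic) = 1"
    using padic_norm_eq_of_close[of t "of_nat c"] c r1 t by simp
  then have nd: "\<not> CARD('p) dvd c" by (simp add: padic_norm_of_nat_eq_1_iff)
  have "padic_norm (b i - of_nat c * a i) \<le> ?r" if i: "i \<in> I" for i
  proof (rule padic_norm_diff_trans[OF t(2)[OF i]])
    have "padic_norm (a i) \<le> 1" using a i unfolding unit_sphere_iff[OF I] by auto
    then have "padic_norm (t - of_nat c) * padic_norm (a i) \<le> ?r * 1"
      using c by (intro mult_mono) auto
    then show "padic_norm (t * a i - of_nat c * a i) \<le> ?r"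
      by (simp add: padic_norm_mult flip: left_diff_distrib)
  qed
  then have "b \<in> polyball I (\<lambda>i. of_nat c * a i) m"
    using b unfolding unit_sphere_iff[OF I] by (auto simp: polyball_def padic_ball_def PiE_iff)
  with c nd show "b \<in> (\<Union>c\<in>{c. c < CARD('p) ^ m \<and> \<not> CARD('p) dvd c}. polyball I (\<lambda>i. of_nat c * a i) m)" by blast
next
  let ?r = "1 / real CARD('p) ^ m"
  have r1: "?r < 1" by (rule inverse_power_CARD_less_1[OF m])
  fix b assume "b \<in> (\<Union>c\<in>{c. c < CARD('p) ^ m \<and> \<not> CARD('p) dvd c}. polyball I (\<lambda>i. of_nat c * a i) m)"
  then obtain c where c: "\<not> CARD('p) dvd c" and b: "b \<in> polyball I (\<lambda>i. of_nat c * a i) m" by blast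
  have c1: "padic_norm (of_nat c :: 'p padic) = 1" using c by (simp add: padic_norm_of_nat_eq_1_iff)
  have close: "padic_norm (b i - of_nat c * a i) \<le> ?r" if "i \<in> I" for i
    using b that by (auto simp: polyball_def padic_ball_def PiE_iff)
  have "padic_norm (b i) \<le> 1" if "i \<in> I" for i
  proof -
    have "padic_norm (of_nat c * a i) \<le> 1" using a that c1 unfolding unit_sphere_iff[OF I] by (simp add: padic_norm_mult)
    then show ?thesis using padic_norm_add_le[of "b i - of_nat c * a i" 1 "of_nat c * a i"] close[OF that] r1 by simp
  qed
  moreover obtain k where k: "k \<in> I" "padic_norm (a k) = 1" using a unfolding unit_sphere_iff[OF I] by auto
  have "padic_norm (b k) = 1"
    using padic_norm_eq_of_close[of "of_nat c * a k" "b k"] close[OF k(1)] r1 k c1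
    by (simp add: padic_norm_mult padic_norm_diff_commute)
  ultimately have "b \<in> unit_sphere I"
    using b k unfolding unit_sphere_iff[OF I] by (auto simp: polyball_def PiE_iff)
  with close c1 show "b \<in> ball_cone I a m" unfolding ball_cone_def unit_close_def by blast
qed

lemma card_units_mod_prime_power:
  assumes "p > 1" "m \<ge> 1"
  shows "card {c. c < p ^ m \<and> \<not> p dvd (c :: nat)} = p ^ m - p ^ (m - 1)"
proof -
  have pm: "p ^ m = p * p ^ (m - 1)" using assms by (cases m) auto
  have "{c. c < p ^ m \<and> \<not> p dvd c} = {..<p ^ m} - (*) p ` {..<p ^ (m - 1)}"
    using assms unfolding pm by (auto elim!: dvdE)
  also have "card \<dots> = p ^ m - card ((*) p ` {..<p ^ (m - 1)})"
    using assms unfolding pm by (subst card_Diff_subset) auto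
  also have "card ((*) p ` {..<p ^ (m - 1)}) = p ^ (m - 1)"
    using assms by (subst card_image) (auto simp: inj_on_def)
  finally show ?thesis .
qed

text \<open>
There are \<open>p ^ m - p ^ (m - 1)\<close> residues \<open>c\<close> prime to \<open>p\<close>.  The polydiscs around the vectors \<open>c * a\<close> are
disjoint, because \<open>a\<close> has a unit coordinate, in which \<open>c\<close> can be read off modulo \<open>p ^ m\<close>.
\<close>
lemma emeasure_ball_cone:
  fixes a :: "'i \<Rightarrow> 'p :: prime_card padic"
  assumes I: "finite I" "I \<noteq> {}" and m: "m \<ge> 1" and a: "a \<in> unit_sphere I"
  shows "ball_cone I a m \<in> sets (haar_measure I)"
    "emeasure (haar_measure I) (ball_cone I a m)
       = ennreal ((1 - 1 / real CARD('p)) / real CARD('p) ^ (m * (card I - 1)))"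
proof -
  let ?M = "haar_measure I :: ('i \<Rightarrow> 'p padic) measure"
  let ?U = "{c. c < CARD('p) ^ m \<and> \<not> CARD('p) dvd c}"
  let ?F = "\<lambda>c. polyball I (\<lambda>i. of_nat c * a i) m"
  note haar = is_haar_measure_haar_measure[OF I(1), where 'p = 'p]
  have fin: "finite ?U" by simp
  show "ball_cone I a m \<in> sets ?M"
    unfolding ball_cone_eq_UN_polyball[OF I m a] using fin polyball_sets[OF I(1) haar] by auto
  obtain k where k: "k \<in> I" "padic_norm (a k) = 1" using a unfolding unit_sphere_iff[OF I] by auto
  have "disjoint_family_on ?F ?U" unfolding disjoint_family_on_def
  proof (intro ballI impI)
    fix c c' assume c: "c \<in> ?U" "c' \<in> ?U" "c \<noteq> c'"
    show "?F c \<inter> ?F c' = {}"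
    proof (rule ccontr)
      assume "?F c \<inter> ?F c' \<noteq> {}"
      from polyball_meet_imp_close[OF this k(1)] have "padic_norm (of_nat c - of_nat c' :: 'p padic) \<le> 1 / real CARD('p) ^ m"
        using k by (simp add: padic_norm_mult flip: left_diff_distrib)
      then show False using padic_residue_unique[of c m c', where 'p = 'p] c by auto
    qed
  qed
  then have "emeasure ?M (ball_cone I a m) = (\<Sum>c\<in>?U. emeasure ?M (?F c))"
    unfolding ball_cone_eq_UN_polyball[OF I m a] using fin polyball_sets[OF I(1) haar]
    by (intro sum_emeasure[symmetric]) auto
  also have "\<dots> = ennreal (real (card ?U) * (1 / real CARD('p) ^ (m * card I)))"
    by (simp only: emeasure_polyball[OF I(1) haar] sum_constant ennreal_of_nat_eq_real_of_nat)
      (rule ennreal_mult[symmetric]; simp)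
  also have "real (card ?U) * (1 / real CARD('p) ^ (m * card I))
      = (1 - 1 / real CARD('p)) / real CARD('p) ^ (m * (card I - 1))"
  proof -
    have "real (card ?U) = real CARD('p) ^ m - real CARD('p) ^ (m - 1)"
      unfolding card_units_mod_prime_power[OF CARD_gt_1 m]
      by (subst of_nat_diff) (auto intro: power_increasing)
    also have "\<dots> = real CARD('p) ^ m * (1 - 1 / real CARD('p))"
      using m by (cases m) (auto simp: field_simps)
    moreover have "m * card I = m + m * (card I - 1)"
      using I by (cases "card I") auto
    ultimately show ?thesis by (simp add: power_add)
  qed
  finally show "emeasure ?M (ball_cone I a m)
       = ennreal ((1 - 1 / real CARD('p)) / real CARD('p) ^ (m * (card I - 1)))" .
qed

text \<open>
The cone depends only on the coordinates modulo \<open>p ^ m\<close>.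
\<close>
lemma finite_ball_cones:
  assumes I: "finite I" "I \<noteq> {}" and A: "A \<subseteq> unit_sphere I"
  shows "finite ((\<lambda>a. ball_cone I a m) ` (A :: ('i \<Rightarrow> 'p :: prime_card padic) set))"
proof (rule finite_subset)
  let ?R = "I \<rightarrow>\<^sub>E {..<CARD('p) ^ m}"
  show "finite ((\<lambda>c. ball_cone I (\<lambda>i. of_nat (c i) :: 'p padic) m) ` ?R)"
    using I by (intro finite_imageI finite_PiE) auto
  show "(\<lambda>a. ball_cone I a m) ` A \<subseteq> (\<lambda>c. ball_cone I (\<lambda>i. of_nat (c i) :: 'p padic) m) ` ?R"
  proof (rule image_subsetI)
    fix a assume "a \<in> A"
    then have "\<And>i. i \<in> I \<Longrightarrow> padic_norm (a i) \<le> 1" using A I unit_sphere_iff[OF I] by blast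
    then have "\<forall>i\<in>I. \<exists>c. c < CARD('p) ^ m \<and> padic_norm (a i - of_nat c) \<le> 1 / real CARD('p) ^ m"
      using padic_residue[of _ m] by metis
    then obtain c where c: "\<And>i. i \<in> I \<Longrightarrow> c i < CARD('p) ^ m \<and> padic_norm (a i - of_nat (c i)) \<le> 1 / real CARD('p) ^ m"
      by metis
    then have "ball_cone I (\<lambda>i. of_nat (restrict c I i) :: 'p padic) m = ball_cone I a m"
      by (intro ball_cone_cong unit_close_of_close) auto
    then show "ball_cone I a m \<in> (\<lambda>c. ball_cone I (\<lambda>i. of_nat (c i) :: 'p padic) m) ` ?R"
      using c by (intro image_eqI[of _ _ "restrict c I"]) auto
  qed
qed

text \<open>
The cones are the classes of an equivalence relation, hence equal or disjoint, and all have the same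
measure.  The factor \<open>1 - 1 / p\<close> in it cancels the normalisation of the projective measure.
\<close>
lemma proj_measure_tube:
  fixes A :: "('i \<Rightarrow> 'p :: prime_card padic) set"
  assumes I: "finite I" "I \<noteq> {}" and m: "m \<ge> 1" and A: "A \<subseteq> unit_sphere I"
  shows "proj_measure I (\<Union>x\<in>proj_point I ` A. proj_ball I x (1 / real CARD('p) ^ m))
    = real (card ((\<lambda>a. ball_cone I a m) ` A)) / real CARD('p) ^ (m * (card I - 1))"
proof -
  let ?M = "haar_measure I :: ('i \<Rightarrow> 'p padic) measure"
  let ?C = "(\<lambda>a. ball_cone I a m) ` A"
  let ?v = "(1 - 1 / real CARD('p)) / real CARD('p) ^ (m * (card I - 1))"
  have v: "?v \<ge> 0" "1 - 1 / real CARD('p) > 0" using CARD_gt_1[where 'p = 'p] by (auto simp: divide_simps)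
  note fin = finite_ball_cones[OF I A]
  have "{b \<in> unit_sphere I. proj_point I b \<in> (\<Union>x\<in>proj_point I ` A. proj_ball I x (1 / real CARD('p) ^ m))} = \<Union>?C"
    using A proj_point_in_proj_ball_iff[OF I _ inverse_power_CARD_less_1[OF m]]
    unfolding ball_cone_def by (auto simp: subset_iff)
  moreover have "emeasure ?M (\<Union>?C) = ennreal (real (card ?C) * ?v)"
  proof -
    have "disjoint_family_on (\<lambda>c. c) ?C"
      unfolding disjoint_family_on_def
    proof (intro ballI impI)
      fix c c' assume c: "c \<in> ?C" "c' \<in> ?C" "c \<noteq> c'"
      then obtain a a' where a: "c = ball_cone I a m" "c' = ball_cone I a' m" by blast
      have "c = c'" if "b \<in> c" "b \<in> c'" for b
        using that ball_cone_cong[of I m a b] ball_cone_cong[of I m a' b]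
        unfolding a by (simp add: ball_cone_def)
      with c show "c \<inter> c' = {}" by blast
    qed
    moreover have "(\<lambda>c. c) ` ?C \<subseteq> sets ?M" using A emeasure_ball_cone(1)[OF I m] by auto
    ultimately have "emeasure ?M (\<Union>?C) = (\<Sum>c\<in>?C. emeasure ?M c)"
      using sum_emeasure[of "\<lambda>c. c" ?C ?M] fin[of m] by simp
    also have "\<dots> = (\<Sum>c\<in>?C. ennreal ?v)"
      using A emeasure_ball_cone(2)[OF I m] by (intro sum.cong) auto
    also have "\<dots> = ennreal (real (card ?C) * ?v)"
      by (simp only: sum_constant ennreal_of_nat_eq_real_of_nat ennreal_mult[OF of_nat_0_le_iff v(1)])
    finally show ?thesis .
  qed
  ultimately have "proj_measure I (\<Union>x\<in>proj_point I ` A. proj_ball I x (1 / real CARD('p) ^ m))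
      = 1 / (1 - 1 / real CARD('p)) * (real (card ?C) * ?v)"
    unfolding proj_measure_def using v by (simp add: measure_def)
  also have "\<dots> = real (card ?C) / real CARD('p) ^ (m * (card I - 1))"
    using v(2) by simp
  finally show ?thesis .
qed


section \<open>The Veronese map preserves balls\<close>

lemma padic_norm_mult_diff_le:
  assumes "padic_norm x \<le> 1" "padic_norm y' \<le> 1" "padic_norm (x - y) \<le> r" "padic_norm (x' - y') \<le> r"
  shows "padic_norm (x * x' - y * y' :: 'p :: prime_card padic) \<le> r"
proof -
  have e: "x * x' - y * y' = x * (x' - y') + (x - y) * y'" by (simp add: algebra_simps)
  have "padic_norm (x * (x' - y')) \<le> padic_norm (x' - y')" "padic_norm ((x - y) * y') \<le> padic_norm (x - y)"
    using assms by (auto simp: padic_norm_mult intro: mult_left_le_one_le mult_right_le_one_le)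
  then show ?thesis unfolding e using assms by (intro padic_norm_add_le) auto
qed

lemma padic_norm_power_le_1: "padic_norm x \<le> 1 \<Longrightarrow> padic_norm (x ^ k :: 'p :: prime_card padic) \<le> 1"
  by (simp add: padic_norm_power power_le_one)

lemma padic_norm_power_diff_le:
  assumes "0 \<le> r" "padic_norm x \<le> 1" "padic_norm y \<le> 1" "padic_norm (x - y) \<le> r"
  shows "padic_norm (x ^ k - y ^ k :: 'p :: prime_card padic) \<le> r"
proof (induction k)
  case (Suc k)
  then show ?case using assms padic_norm_mult_diff_le[of x "y ^ k" y r "x ^ k"] padic_norm_power_le_1[of y k] by simp
qed (use assms in auto)

lemma padic_norm_prod: "padic_norm (\<Prod>i\<in>I. x i :: 'p :: prime_card padic) = (\<Prod>i\<in>I. padic_norm (x i))"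
  by (induction I rule: infinite_finite_induct) (auto simp: padic_norm_mult)

lemma padic_norm_prod_diff_le:
  assumes "0 \<le> r" "\<And>i. i \<in> I \<Longrightarrow> padic_norm (x i) \<le> 1" "\<And>i. i \<in> I \<Longrightarrow> padic_norm (y i) \<le> 1"
    "\<And>i. i \<in> I \<Longrightarrow> padic_norm (x i - y i) \<le> r"
  shows "padic_norm ((\<Prod>i\<in>I. x i) - (\<Prod>i\<in>I. y i) :: 'p :: prime_card padic) \<le> r"
  using assms(2-)
proof (induction I rule: infinite_finite_induct)
  case (insert i I)
  have "padic_norm (\<Prod>i\<in>I. y i) \<le> 1"
    unfolding padic_norm_prod using insert.prems by (intro prod_le_1) auto
  then show ?case using insert padic_norm_mult_diff_le[of "x i" "\<Prod>i\<in>I. y i" "y i" r "\<Prod>i\<in>I. x i"] by simp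
qed (use assms(1) in auto)

lemma finite_multi_indices: "finite (multi_indices n d)"
  by (rule card_ge_0_finite) (simp add: card_multi_indices)

lemma multi_indices_nonempty: "multi_indices n d \<noteq> {}"
  using card_multi_indices[of n d] by auto

lemma monomial_vector_scale:
  "monomial_vector n d (\<lambda>i\<in>{0..n}. c * a i) = (\<lambda>\<alpha>\<in>multi_indices n d. c ^ d * monomial_vector n d a \<alpha>)"
proof (rule ext)
  fix \<alpha>
  have "(\<Prod>i = 0..n. (c * a i) ^ \<alpha> i) = c ^ d * (\<Prod>i = 0..n. a i ^ \<alpha> i)" if "\<alpha> \<in> multi_indices n d"
  proof -
    have "(\<Prod>i = 0..n. c ^ \<alpha> i) = c ^ (\<Sum>i = 0..n. \<alpha> i)" by (simp add: power_sum)
    also have "(\<Sum>i = 0..n. \<alpha> i) = d" using that by (simp add: multi_indices_def)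
    finally show ?thesis by (simp add: power_mult_distrib prod.distrib)
  qed
  then show "monomial_vector n d (\<lambda>i\<in>{0..n}. c * a i) \<alpha>
      = (\<lambda>\<alpha>\<in>multi_indices n d. c ^ d * monomial_vector n d a \<alpha>) \<alpha>"
    by (simp add: monomial_vector_def)
qed

text \<open>
The exponent of the monomial \<open>x\<^sub>i ^ (d - 1) * x\<^sub>j\<close>, with \<open>j = i\<close> permitted.  These monomials alone
suffice to recover a point from its image.
\<close>
definition adjacent_index :: "nat \<Rightarrow> nat \<Rightarrow> nat \<Rightarrow> nat \<Rightarrow> nat \<Rightarrow> nat" where
  "adjacent_index n d i j = (\<lambda>k\<in>{0..n}. (if k = i then d - 1 else 0) + (if k = j then 1 else 0))"

lemma adjacent_index:
  assumes "d \<ge> 1" "i \<le> n" "j \<le> n"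
  shows "adjacent_index n d i j \<in> multi_indices n d"
    "monomial_vector n d a (adjacent_index n d i j) = a i ^ (d - 1) * a j"
proof -
  show m: "adjacent_index n d i j \<in> multi_indices n d"
    using assms by (auto simp: multi_indices_def adjacent_index_def sum.distrib sum.delta)
  have "(\<Prod>k = 0..n. a k ^ adjacent_index n d i j k)
      = (\<Prod>k = 0..n. (if k = i then a k ^ (d - 1) else 1) * (if k = j then a k else 1))"
    by (intro prod.cong) (auto simp: adjacent_index_def power_add)
  also have "\<dots> = a i ^ (d - 1) * a j" using assms by (simp add: prod.distrib prod.delta)
  finally show "monomial_vector n d a (adjacent_index n d i j) = a i ^ (d - 1) * a j"
    using m by (simp add: monomial_vector_def)
qed

lemma unit_sphereD:
  fixes n :: nat
  assumes "a \<in> unit_sphere {0..n}"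
  shows "a \<in> {0..n} \<rightarrow>\<^sub>E UNIV" "\<And>i. i \<le> n \<Longrightarrow> padic_norm (a i) \<le> 1" "\<exists>i\<le>n. padic_norm (a i) = 1"
  using assms by (auto simp: unit_sphere_iff)

lemma monomial_vector_in_unit_sphere:
  assumes d: "d \<ge> 1" and a: "a \<in> unit_sphere {0..n}"
  shows "monomial_vector n d a \<in> unit_sphere (multi_indices n d)"
proof -
  obtain i where i: "i \<le> n" "padic_norm (a i) = 1" using unit_sphereD(3)[OF a] by blast
  have "padic_norm (monomial_vector n d a (adjacent_index n d i i)) = 1"
    using i by (simp add: adjacent_index[OF d] padic_norm_mult padic_norm_power)
  moreover have "padic_norm (monomial_vector n d a \<alpha>) \<le> 1" if "\<alpha> \<in> multi_indices n d" for \<alpha>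
    using that unit_sphereD(2)[OF a] unfolding monomial_vector_def
    by (auto simp: padic_norm_prod intro!: prod_le_1 padic_norm_power_le_1)
  ultimately show ?thesis
    unfolding unit_sphere_iff[OF finite_multi_indices multi_indices_nonempty]
    using adjacent_index(1)[OF d i(1) i(1)] by (auto simp: monomial_vector_def)
qed

text \<open>
If \<open>b\<close> is congruent to \<open>t * a\<close>, then every monomial in \<open>b\<close> is congruent to \<open>t ^ d\<close> times the monomial in
\<open>a\<close>.  For the converse let \<open>a i\<close> be a unit.  Comparing the \<open>d\<close>-th powers shows that \<open>b i\<close> is a
unit too, and dividing the congruences for the monomials \<open>x\<^sub>i ^ (d - 1) * x\<^sub>j\<close> by the unit
\<open>b i ^ (d - 1)\<close> gives one common factor \<open>t\<close> for all coordinates \<open>j\<close>.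
\<close>
lemma unit_close_monomial_vector_iff:
  assumes d: "d \<ge> 1" and r: "0 \<le> r" "r < 1"
    and a: "a \<in> unit_sphere {0..n}" and b: "b \<in> unit_sphere {0..n}"
  shows "unit_close (multi_indices n d) r (monomial_vector n d a) (monomial_vector n d b)
    \<longleftrightarrow> unit_close {0..n} r a b"
proof
  assume "unit_close {0..n} r a b"
  then obtain t where t: "padic_norm t = 1" "\<And>i. i \<in> {0..n} \<Longrightarrow> padic_norm (b i - t * a i) \<le> r"
    unfolding unit_close_def by blast
  have "padic_norm (monomial_vector n d b \<alpha> - t ^ d * monomial_vector n d a \<alpha>) \<le> r"
    if \<alpha>: "\<alpha> \<in> multi_indices n d" for \<alpha>
  proof -
    have "t ^ d * monomial_vector n d a \<alpha> = monomial_vector n d (\<lambda>i\<in>{0..n}. t * a i) \<alpha>"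
      using \<alpha> by (simp add: monomial_vector_scale)
    also have "\<dots> = (\<Prod>i = 0..n. (t * a i) ^ \<alpha> i)" using \<alpha> by (simp add: monomial_vector_def)
    finally show ?thesis
      using \<alpha> t r unit_sphereD(2)[OF a] unit_sphereD(2)[OF b]
      by (auto simp: monomial_vector_def padic_norm_mult
          intro!: padic_norm_prod_diff_le padic_norm_power_diff_le padic_norm_power_le_1)
  qed
  moreover have "padic_norm (t ^ d) = 1" using t by (simp add: padic_norm_power)
  ultimately show "unit_close (multi_indices n d) r (monomial_vector n d a) (monomial_vector n d b)"
    unfolding unit_close_def by blast
next
  assume "unit_close (multi_indices n d) r (monomial_vector n d a) (monomial_vector n d b)"
  then obtain s where s: "padic_norm s = 1"
    "\<And>\<alpha>. \<alpha> \<in> multi_indices n d \<Longrightarrow> padic_norm (monomial_vector n d b \<alpha> - s * monomial_vector n d a \<alpha>) \<le> r"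
    unfolding unit_close_def by blast
  obtain i where i: "i \<le> n" "padic_norm (a i) = 1" using unit_sphereD(3)[OF a] by blast
  have close: "padic_norm (b i ^ (d - 1) * b j - s * (a i ^ (d - 1) * a j)) \<le> r" if "j \<le> n" for j
    using s(2)[OF adjacent_index(1)[OF d i(1) that]] by (simp add: adjacent_index(2)[OF d i(1) that])
  have sa: "padic_norm (s * (a i ^ (d - 1) * a i)) = 1" using s i by (simp add: padic_norm_mult padic_norm_power)
  have "padic_norm (b i ^ (d - 1) * b i) = 1"
    using padic_norm_eq_of_close[of "s * (a i ^ (d - 1) * a i)" "b i ^ (d - 1) * b i"] close[OF i(1)] r sa
    by (simp add: padic_norm_diff_commute[of "s * _"])
  then have "padic_norm (b i) ^ (d - 1) * padic_norm (b i) = 1" by (simp add: padic_norm_mult padic_norm_power)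
  moreover have "padic_norm (b i) ^ (d - 1) * padic_norm (b i) \<le> padic_norm (b i) ^ (d - 1)"
    using unit_sphereD(2)[OF b i(1)] by (intro mult_left_le) auto
  moreover have "padic_norm (b i) ^ (d - 1) \<le> 1"
    using unit_sphereD(2)[OF b i(1)] by (intro power_le_one) auto
  ultimately have bi: "padic_norm (b i ^ (d - 1)) = 1" by (simp add: padic_norm_power)
  then have b0: "b i ^ (d - 1) \<noteq> 0" by (metis padic_norm_zero zero_neq_one)
  \<comment> \<open>The same factor serves all \<open>j\<close>, since \<open>close\<close> involves \<open>j\<close> only through \<open>a j\<close> and \<open>b j\<close>.\<close>
  define t where "t = s * a i ^ (d - 1) / b i ^ (d - 1)"
  have "padic_norm (b j - t * a j) \<le> r" if "j \<in> {0..n}" for j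
  proof -
    have "b i ^ (d - 1) * (b j - t * a j) = b i ^ (d - 1) * b j - s * (a i ^ (d - 1) * a j)"
      unfolding t_def using b0 by (simp add: field_simps)
    then have "padic_norm (b i ^ (d - 1) * (b j - t * a j)) \<le> r" using close[of j] that by simp
    then show ?thesis using bi by (simp add: padic_norm_mult)
  qed
  moreover have "padic_norm t = 1"
    using s i bi by (simp add: t_def padic_norm_divide padic_norm_mult padic_norm_power)
  ultimately show "unit_close {0..n} r a b" unfolding unit_close_def by blast
qed

lemma veronese_proj_point:
  assumes "a \<in> {0..n} \<rightarrow>\<^sub>E UNIV"
  shows "veronese n d (proj_point {0..n} a) = proj_point (multi_indices n d) (monomial_vector n d a)"
proof -
  have "(SOME b. b \<in> proj_point {0..n} a) \<in> proj_point {0..n} a"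
    using proj_point_self[OF assms] by (rule someI[of "\<lambda>b. b \<in> proj_point {0..n} a"])
  then obtain c where c: "c \<noteq> 0" "(SOME b. b \<in> proj_point {0..n} a) = (\<lambda>i\<in>{0..n}. c * a i)"
    unfolding proj_point_def by auto
  then have "c ^ d \<noteq> 0" by simp
  then show ?thesis unfolding veronese_def c(2) monomial_vector_scale by (rule proj_point_scale)
qed

lemma card_image_eq_of_same_kernel:
  assumes "\<And>x y. x \<in> A \<Longrightarrow> y \<in> A \<Longrightarrow> f x = f y \<longleftrightarrow> g x = g y"
  shows "card (f ` A) = card (g ` A)"
proof -
  let ?h = "\<lambda>u. g (inv_into A f u)"
  have h: "?h (f x) = g x" if "x \<in> A" for x
  proof -
    have "f x \<in> f ` A" using that by (rule imageI)
    then show ?thesis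
      using assms[OF inv_into_into that, of "f x"] f_inv_into_f[of "f x" f A] by simp
  qed
  have "?h ` f ` A = g ` A" unfolding image_image using h by (intro image_cong refl)
  moreover have "inj_on ?h (f ` A)" using h assms by (intro inj_onI) auto
  ultimately show ?thesis using card_image by fastforce
qed

lemma card_ball_cones_monomial_vector:
  assumes d: "d \<ge> 1" and m: "m \<ge> 1"
  shows "card ((\<lambda>a. ball_cone (multi_indices n d) a m) ` monomial_vector n d ` (unit_sphere {0..n} :: (nat \<Rightarrow> 'p :: prime_card padic) set))
    = card ((\<lambda>a. ball_cone {0..n} a m) ` (unit_sphere {0..n} :: (nat \<Rightarrow> 'p padic) set))"
  unfolding image_image
proof (rule card_image_eq_of_same_kernel)
  fix a b :: "nat \<Rightarrow> 'p padic" assume a: "a \<in> unit_sphere {0..n}" and b: "b \<in> unit_sphere {0..n}"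
  show "ball_cone (multi_indices n d) (monomial_vector n d a) m = ball_cone (multi_indices n d) (monomial_vector n d b) m
      \<longleftrightarrow> ball_cone {0..n} a m = ball_cone {0..n} b m"
    using unit_close_monomial_vector_iff[OF d _ inverse_power_CARD_less_1[OF m] a b]
    by (simp add: ball_cone_eq_iff a monomial_vector_in_unit_sphere[OF d a])
qed

text \<open>
The two tubes consist of the same number of balls, and the powers of \<open>p\<close> compensate exactly for the
different dimensions of the ambient spaces.
\<close>
lemma tube_volume_veronese:
  assumes d: "d \<ge> 1" and m: "m \<ge> 1"
  shows "real CARD('p :: prime_card) powi (int m * (int (card (multi_indices n d)) - 1 - int n)) *
      proj_measure (multi_indices n d) (\<Union>x\<in>veronese n d ` (proj_space {0..n} :: (nat \<Rightarrow> 'p padic) set set).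
        proj_ball (multi_indices n d) x (1 / real CARD('p) ^ m))
    = real CARD('p) powi (int m * (int (card {0..n}) - 1 - int n)) *
      proj_measure {0..n} (\<Union>x\<in>(proj_space {0..n} :: (nat \<Rightarrow> 'p padic) set set).
        proj_ball {0..n} x (1 / real CARD('p) ^ m))"
proof -
  let ?S = "unit_sphere {0..n} :: (nat \<Rightarrow> 'p padic) set"
  let ?J = "multi_indices n d"
  let ?K = "real (card ((\<lambda>a. ball_cone {0..n} a m) ` ?S))"
  have P: "proj_space {0..n} = proj_point {0..n} ` ?S"
    by (rule proj_space_eq_image_sphere) auto
  have sub: "monomial_vector n d ` ?S \<subseteq> unit_sphere ?J"
    using monomial_vector_in_unit_sphere[OF d] by blast
  have "veronese n d ` proj_space {0..n} = proj_point ?J ` monomial_vector n d ` ?S"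
    unfolding P image_image by (intro image_cong refl veronese_proj_point unit_sphereD(1))
  then have V: "proj_measure ?J (\<Union>x\<in>veronese n d ` (proj_space {0..n} :: (nat \<Rightarrow> 'p padic) set set).
        proj_ball ?J x (1 / real CARD('p) ^ m)) = ?K / real CARD('p) ^ (m * (card ?J - 1))"
    by (simp only: proj_measure_tube[OF finite_multi_indices multi_indices_nonempty m sub]
        card_ball_cones_monomial_vector[OF d m])
  have U: "proj_measure {0..n} (\<Union>x\<in>(proj_space {0..n} :: (nat \<Rightarrow> 'p padic) set set).
        proj_ball {0..n} x (1 / real CARD('p) ^ m)) = ?K / real CARD('p) ^ (m * n)"
    using proj_measure_tube[OF _ _ m, of "{0..n}" ?S] unfolding P by simp
  have "card ?J \<noteq> 0" by (simp add: card_multi_indices)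
  then have exponent: "int m * (int (card ?J) - 1 - int n) = int (m * (card ?J - 1)) - int (m * n)"
    by (simp add: algebra_simps of_nat_diff)
  have "real CARD('p) powi (int a - int b) / real CARD('p) ^ a = 1 / real CARD('p) ^ b" for a b
    by (simp add: power_int_diff)
  then have "real CARD('p) powi (int m * (int (card ?J) - 1 - int n)) / real CARD('p) ^ (m * (card ?J - 1))
      = 1 / real CARD('p) ^ (m * n)"
    unfolding exponent by blast
  then show ?thesis unfolding U V by (simp add: field_simps)
qed

theorem proposition38:
  fixes n d :: nat
  assumes "n \<ge> 1" and "d \<ge> 1"
  shows "proj_vol (multi_indices n d) n
             (veronese n d ` (proj_space {0..n} :: (nat \<Rightarrow> 'p :: prime_card padic) set set))
         = proj_vol {0..n} n (proj_space {0..n} :: (nat \<Rightarrow> 'p padic) set set)"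
proof -
  have lim_cong: "lim f = lim g" if "\<And>m. m \<ge> 1 \<Longrightarrow> f m = g m" for f g :: "nat \<Rightarrow> real"
  proof -
    \<comment> \<open>At \<open>m = 0\<close> the radius is \<open>1\<close> and the two sequences may differ.\<close>
    have "eventually (\<lambda>m. f m = g m) sequentially"
      using that unfolding eventually_sequentially by blast
    then show ?thesis unfolding lim_def by (simp add: tendsto_cong)
  qed
  show ?thesis unfolding proj_vol_def by (rule lim_cong) (rule tube_volume_veronese[OF assms(2)])
qed

end
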